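(* Let $\mathcal U\subset\mathcal P(\mathbb N)$ be a family of infinite subsets of $\mathbb N$ such that: (i) $\mathcal U$ is closed under finite intersections and under finite modifications of its elements; (ii) $\mathcal U$ is $\aleph_1$-generated, that is, there exist $X_\xi\in\mathcal U$, $\xi<\omega_1$, such that for any $X\in\mathcal U$ there exists $\xi$ with $X_\xi\subset^* X$; (iii) for any $f\in\mathbb N^{\mathbb N}$ there exists $X\in\mathcal U$ such that $f(i)\le n(X,i)$ for all but finitely many $i\in\mathbb N$. Then the inverse limit $\varprojlim_{X\in\mathcal U}\mathbf G_X$ has cardinality $2^{\aleph_1}$.
   Context: $\mathbb N$ includes $0$; $\mathbb T$ is the unit circle in $\mathbb C$, and $\mathbb T^{\mathbb N}$ is a group under pointwise multiplication. $Y\subset^*X$ means that $Y\setminus X$ is finite. For an infinite $X\subset\mathbb N$ and $j\in\mathbb N$, $n(X,j)$ denotes the $j$-th element (counting from $j=0$, so $n(X,0)=0$) in the increasing enumeration of $\{0\}\cup X$, and $I(X,j)=[\,n(X,j),n(X,j+1)\,)$. For finite $I\subset\mathbb N$ and $\alpha,\beta\in\mathbb T^{\mathbb N}$ let $\Delta_I(\alpha,\beta)=\max_{i,j\in I}|\alpha(i)\overline{\alpha(j)}-\beta(i)\overline{\beta(j)}|$. For infinite $X\subset\mathbb N$ let $\mathbf F_X=\{\alpha\in\mathbb T^{\mathbb N}:\lim_{j\to\infty}\Delta_{I(X,j)\cup I(X,j+1)}(\alpha,1)=0\}$, where $1$ is the constant function, and let $\mathbf G_X=\mathbb T^{\mathbb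 N}/\mathbf F_X$ (a discrete group). If $Y\subset^*X$ then $\mathbf F_Y\subset\mathbf F_X$, so there is a natural quotient map $\mathbf G_Y\to\mathbf G_X$; with these maps $(\mathbf G_X)_{X\in\mathcal U}$ is an inverse system indexed by $\mathcal U$ directed by $\supset^*$ (smaller sets come later). *)

theory Defs
  imports Complex_Main "HOL-Library.Infinite_Set" "HOL-Algebra.Product_Groups"
begin

unbundle cardinal_syntax

definition almost_subset :: "'a set \<Rightarrow> 'a set \<Rightarrow> bool"  (infix \<open>\<subseteq>\<^sup>*\<close> 50)
  where "Y \<subseteq>\<^sup>* X \<longleftrightarrow> finite (Y - X)"

abbreviation aleph1 :: "nat set rel"
  where "aleph1 \<equiv> cardSuc natLeq"

definition nth_el :: "nat set \<Rightarrow> nat \<Rightarrow> nat"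
  where "nth_el X j = enumerate (insert 0 X) j"

definition interval :: "nat set \<Rightarrow> nat \<Rightarrow> nat set"
  where "interval X j = {nth_el X j..<nth_el X (Suc j)}"

definition circle_group :: "complex monoid"
  where "circle_group = \<lparr>carrier = {z. cmod z = 1}, mult = (*), one = 1\<rparr>"

definition torus :: "(nat \<Rightarrow> complex) monoid"
  where "torus = product_group UNIV (\<lambda>_. circle_group)"

text \<open>Only used for finite nonempty \<open>I\<close>.\<close>

definition Delta :: "nat set \<Rightarrow> (nat \<Rightarrow> complex) \<Rightarrow> (nat \<Rightarrow> complex) \<Rightarrow> real"
  where "Delta I \<alpha> \<beta> =
    Max ((\<lambda>(i, j). cmod (\<alpha> i * cnj (\<alpha> j) - \<beta> i * cnj (\<beta> j))) ` (I \<times> I))"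

definition F_grp :: "nat set \<Rightarrow> (nat \<Rightarrow> complex) set"
  where "F_grp X = {\<alpha> \<in> carrier torus.
    (\<lambda>j. Delta (interval X j \<union> interval X (Suc j)) \<alpha> (\<lambda>_. 1)) \<longlonglongrightarrow> 0}"

definition G_grp :: "nat set \<Rightarrow> (nat \<Rightarrow> complex) set monoid"
  where "G_grp X = torus Mod F_grp X"

text \<open>
  The natural map \<open>G_grp Y \<rightarrow> G_grp X\<close> for \<open>Y \<subseteq>\<^sup>* X\<close> sends a coset \<open>C\<close> of \<open>F_grp Y\<close> to the coset of
  \<open>F_grp X\<close> containing it, which is the product set \<open>F_grp X \<cdot> C\<close>; see \<open>quot_map_coset\<close> below. The
  formula does not involve \<open>Y\<close>.
\<close>

definition quot_map :: "nat set \<Rightarrow> nat set \<Rightarrow> (nat \<Rightarrow> complex) set \<Rightarrow> (nat \<Rightarrow> complex) set"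
  where "quot_map Y X C = F_grp X <#>\<^bsub>torus\<^esub> C"

text \<open>
  \<open>later i j\<close> means that \<open>j\<close> comes later than \<open>i\<close>, and \<open>f j i\<close> is the connecting map from \<open>G j\<close> to \<open>G i\<close>.
\<close>

definition inverse_limit ::
  "'i set \<Rightarrow> ('i \<Rightarrow> 'i \<Rightarrow> bool) \<Rightarrow> ('i \<Rightarrow> 'g monoid) \<Rightarrow> ('i \<Rightarrow> 'i \<Rightarrow> 'g \<Rightarrow> 'g) \<Rightarrow> ('i \<Rightarrow> 'g) monoid"
  where "inverse_limit I later G f = (product_group I G)
    \<lparr>carrier := {x \<in> carrier (product_group I G).
       \<forall>i\<in>I. \<forall>j\<in>I. later i j \<longrightarrow> f j i (x j) = x i}\<rparr>"

definition lim_G :: "nat set set \<Rightarrow> (nat set \<Rightarrow> (nat \<Rightarrow> complex) set) monoid"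
  where "lim_G U = inverse_limit U (\<lambda>X Y. Y \<subseteq>\<^sup>* X) G_grp quot_map"

text \<open>Each \<open>F_grp X\<close> is a normal subgroup, and \<open>quot_map\<close> is the natural quotient map.\<close>

lemma group_circle: "group circle_group"
proof (rule groupI)
  fix x assume "x \<in> carrier circle_group"
  then show "\<exists>y\<in>carrier circle_group. y \<otimes>\<^bsub>circle_group\<^esub> x = \<one>\<^bsub>circle_group\<^esub>"
    by (intro bexI[of _ "inverse x"]) (auto simp: circle_group_def norm_inverse intro!: left_inverse)
qed (auto simp: circle_group_def norm_mult)

lemma carrier_torus: "carrier torus = {\<alpha>. \<forall>i. cmod (\<alpha> i) = 1}"
  by (auto simp: torus_def circle_group_def)

lemma mult_torus: "\<alpha> \<otimes>\<^bsub>torus\<^esub> \<beta> = (\<lambda>i. \<alpha> i * \<beta> i)"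
  by (simp add: torus_def circle_group_def restrict_def)

lemma one_torus: "\<one>\<^bsub>torus\<^esub> = (\<lambda>_. 1)"
  by (simp add: torus_def circle_group_def restrict_def)

lemma comm_group_torus: "comm_group torus"
proof -
  interpret group torus
    unfolding torus_def by (rule product_group) (rule group_circle)
  show ?thesis
    by unfold_locales (simp add: mult_torus mult.commute)
qed

lemma nth_el_less:
  assumes "infinite X" "i < j"
  shows "nth_el X i < nth_el X j"
  using assms by (simp add: nth_el_def)

lemma nth_el_in:
  assumes "infinite X"
  shows "nth_el X i \<in> insert 0 X"
  unfolding nth_el_def by (rule enumerate_in_set) (use assms in simp)

lemma nth_el_Suc_le:
  assumes "infinite X" "m \<in> insert 0 X" "nth_el X i < m"
  shows "nth_el X (Suc i) \<le> m"
proof -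
  have "nth_el X (Suc i) = (LEAST s. s \<in> insert 0 X \<and> nth_el X i < s)"
    unfolding nth_el_def by (rule enumerate_Suc'') (use assms in simp)
  also have "\<dots> \<le> m"
    using assms by (intro Least_le) auto
  finally show ?thesis .
qed

lemma interval_Un:
  assumes "infinite X"
  shows "interval X j \<union> interval X (Suc j) = {nth_el X j..<nth_el X (Suc (Suc j))}"
  using nth_el_less[OF assms, of j "Suc j"] nth_el_less[OF assms, of "Suc j" "Suc (Suc j)"]
  by (auto simp: interval_def)

lemma Delta_one_le_iff:
  assumes "finite I" "I \<noteq> {}"
  shows "Delta I \<alpha> (\<lambda>_. 1) \<le> e \<longleftrightarrow> (\<forall>i\<in>I. \<forall>j\<in>I. cmod (\<alpha> i * cnj (\<alpha> j) - 1) \<le> e)"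
  using assms by (auto simp: Delta_def)

lemma F_grp_iff:
  assumes "infinite X"
  shows "\<alpha> \<in> F_grp X \<longleftrightarrow> (\<forall>i. cmod (\<alpha> i) = 1) \<and>
    (\<forall>e>0. \<forall>\<^sub>F k in sequentially. \<forall>i\<in>{nth_el X k..<nth_el X (Suc (Suc k))}.
       \<forall>j\<in>{nth_el X k..<nth_el X (Suc (Suc k))}. cmod (\<alpha> i * cnj (\<alpha> j) - 1) \<le> e)"
proof -
  define J where "J k = {nth_el X k..<nth_el X (Suc (Suc k))}" for k
  have J: "finite (J k)" "J k \<noteq> {}" for k
    using nth_el_less[OF assms, of k "Suc (Suc k)"] by (auto simp: J_def)
  have nonneg: "0 \<le> Delta (J k) \<alpha> (\<lambda>_. 1)" for k
  proof -
    obtain i where "i \<in> J k" using J by blast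
    then have "cmod (\<alpha> i * cnj (\<alpha> i) - 1) \<le> Delta (J k) \<alpha> (\<lambda>_. 1)"
      using Delta_one_le_iff[OF J, of k \<alpha> "Delta (J k) \<alpha> (\<lambda>_. 1)"] by blast
    then show ?thesis
      using norm_ge_zero order_trans by blast
  qed
  have "(\<lambda>k. Delta (J k) \<alpha> (\<lambda>_. 1)) \<longlonglongrightarrow> 0 \<longleftrightarrow>
      (\<forall>e>0. \<forall>\<^sub>F k in sequentially. Delta (J k) \<alpha> (\<lambda>_. 1) \<le> e)"
  proof
    assume "(\<lambda>k. Delta (J k) \<alpha> (\<lambda>_. 1)) \<longlonglongrightarrow> 0"
    then show "\<forall>e>0. \<forall>\<^sub>F k in sequentially. Delta (J k) \<alpha> (\<lambda>_. 1) \<le> e"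
      by (auto dest: order_tendstoD(2) elim!: eventually_mono)
  next
    assume *: "\<forall>e>0. \<forall>\<^sub>F k in sequentially. Delta (J k) \<alpha> (\<lambda>_. 1) \<le> e"
    show "(\<lambda>k. Delta (J k) \<alpha> (\<lambda>_. 1)) \<longlonglongrightarrow> 0"
    proof (rule tendstoI)
      fix e :: real assume "0 < e"
      then have "\<forall>\<^sub>F k in sequentially. Delta (J k) \<alpha> (\<lambda>_. 1) \<le> e / 2"
        using *[rule_format, of "e / 2"] half_gt_zero by blast
      then show "\<forall>\<^sub>F k in sequentially. dist (Delta (J k) \<alpha> (\<lambda>_. 1)) 0 < e"
        by eventually_elim (use nonneg \<open>0 < e\<close> in auto)
    qed
  qed
  then show ?thesis
    by (simp add: F_grp_def carrier_torus interval_Un[OF assms] Delta_one_le_iff[OF J]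
        flip: J_def)
qed

lemma subgroup_F_grp:
  assumes "infinite X"
  shows "subgroup (F_grp X) torus"
proof -
  interpret comm_group torus by (rule comm_group_torus)
  show ?thesis
  proof (rule subgroupI)
    show "F_grp X \<subseteq> carrier torus"
      by (auto simp: F_grp_def)
    have "(\<lambda>_. 1) \<in> F_grp X"
      by (simp add: F_grp_iff[OF assms])
    then show "F_grp X \<noteq> {}" by blast
  next
    fix \<alpha> assume \<alpha>: "\<alpha> \<in> F_grp X"
    then have 1: "cmod (\<alpha> i) = 1" for i
      by (simp add: F_grp_iff[OF assms])
    have cnj: "(\<lambda>i. cnj (\<alpha> i)) \<in> F_grp X"
    proof -
      have "cmod (cnj (\<alpha> i) * cnj (cnj (\<alpha> j)) - 1) = cmod (\<alpha> i * cnj (\<alpha> j) - 1)" for i j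
        by (metis complex_cnj_diff complex_cnj_mult complex_cnj_one complex_mod_cnj)
      with \<alpha> show ?thesis
        by (simp add: F_grp_iff[OF assms])
    qed
    have "inv\<^bsub>torus\<^esub> \<alpha> = (\<lambda>i. cnj (\<alpha> i))"
    proof (rule inv_equality)
      show "(\<lambda>i. cnj (\<alpha> i)) \<otimes>\<^bsub>torus\<^esub> \<alpha> = \<one>\<^bsub>torus\<^esub>"
        using 1 by (simp add: mult_torus one_torus mult.commute complex_norm_square[symmetric])
    qed (use 1 in \<open>auto simp: carrier_torus\<close>)
    with cnj show "inv\<^bsub>torus\<^esub> \<alpha> \<in> F_grp X" by simp
  next
    fix \<alpha> \<beta> assume \<alpha>: "\<alpha> \<in> F_grp X" and \<beta>: "\<beta> \<in> F_grp X"
    then have 1: "cmod (\<alpha> i) = 1" "cmod (\<beta> i) = 1" for i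
      by (simp_all add: F_grp_iff[OF assms])
    have le: "cmod (\<alpha> i * \<beta> i * cnj (\<alpha> j * \<beta> j) - 1)
        \<le> cmod (\<alpha> i * cnj (\<alpha> j) - 1) + cmod (\<beta> i * cnj (\<beta> j) - 1)" for i j
    proof -
      have "\<alpha> i * \<beta> i * cnj (\<alpha> j * \<beta> j) - 1
          = (\<alpha> i * cnj (\<alpha> j) - 1) * (\<beta> i * cnj (\<beta> j)) + (\<beta> i * cnj (\<beta> j) - 1)"
        by (simp add: algebra_simps)
      also have "cmod \<dots> \<le> cmod ((\<alpha> i * cnj (\<alpha> j) - 1) * (\<beta> i * cnj (\<beta> j)))
          + cmod (\<beta> i * cnj (\<beta> j) - 1)"
        by (rule norm_triangle_ineq)
      finally show ?thesis
        using 1 by (simp add: norm_mult)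
    qed
    show "\<alpha> \<otimes>\<^bsub>torus\<^esub> \<beta> \<in> F_grp X"
      unfolding F_grp_iff[OF assms] mult_torus
    proof (intro conjI allI impI)
      show "cmod (\<alpha> i * \<beta> i) = 1" for i
        using 1 by (simp add: norm_mult)
    next
      fix e :: real assume "e > 0"
      then have e: "e / 2 > 0" by simp
      have A: "\<forall>\<^sub>F k in sequentially. \<forall>i\<in>{nth_el X k..<nth_el X (Suc (Suc k))}.
         \<forall>j\<in>{nth_el X k..<nth_el X (Suc (Suc k))}. cmod (\<alpha> i * cnj (\<alpha> j) - 1) \<le> e / 2"
        using \<alpha> e unfolding F_grp_iff[OF assms] by blast
      have B: "\<forall>\<^sub>F k in sequentially. \<forall>i\<in>{nth_el X k..<nth_el X (Suc (Suc k))}.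
         \<forall>j\<in>{nth_el X k..<nth_el X (Suc (Suc k))}. cmod (\<beta> i * cnj (\<beta> j) - 1) \<le> e / 2"
        using \<beta> e unfolding F_grp_iff[OF assms] by blast
      from A B show "\<forall>\<^sub>F k in sequentially. \<forall>i\<in>{nth_el X k..<nth_el X (Suc (Suc k))}.
         \<forall>j\<in>{nth_el X k..<nth_el X (Suc (Suc k))}.
           cmod (\<alpha> i * \<beta> i * cnj (\<alpha> j * \<beta> j) - 1) \<le> e"
      proof eventually_elim
        case (elim k)
        show ?case
        proof (intro ballI)
          fix i j assume "i \<in> {nth_el X k..<nth_el X (Suc (Suc k))}"
            "j \<in> {nth_el X k..<nth_el X (Suc (Suc k))}"
          with elim have "cmod (\<alpha> i * cnj (\<alpha> j) - 1) \<le> e / 2" "cmod (\<beta> i * cnj (\<beta> j) - 1) \<le> e / 2"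
            by blast+
          with le[of i j] show "cmod (\<alpha> i * \<beta> i * cnj (\<alpha> j * \<beta> j) - 1) \<le> e"
            by linarith
        qed
      qed
    qed
  qed
qed

lemma normal_F_grp:
  assumes "infinite X"
  shows "F_grp X \<lhd> torus"
  using comm_group.normal_iff_subgroup[OF comm_group_torus] subgroup_F_grp[OF assms] by blast

lemma F_grp_mono:
  assumes "infinite X" "infinite Y" "Y \<subseteq>\<^sup>* X"
  shows "F_grp Y \<subseteq> F_grp X"
proof
  fix \<alpha> assume \<alpha>: "\<alpha> \<in> F_grp Y"
  have "finite (Y - X)" using assms(3) by (simp add: almost_subset_def)
  then obtain M where M: "\<And>m. m \<in> Y - X \<Longrightarrow> m \<le> M"
    by (meson finite_nat_set_iff_bounded_le)
  have ge: "j \<le> nth_el Z j" if "infinite Z" for Z j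
    unfolding nth_el_def by (rule le_enumerate) (use that in simp)
  have 0: "nth_el Z 0 = 0" for Z
    by (simp add: nth_el_def enumerate_0 Least_eq_0)
  have key: "\<exists>k\<ge>K. nth_el Y k \<le> nth_el X j \<and> nth_el X (Suc (Suc j)) \<le> nth_el Y (Suc (Suc k))"
    if j: "j \<ge> M + nth_el Y K" for j K
  proof -
    define k where "k = (GREATEST k. nth_el Y k \<le> nth_el X j)"
    have bound: "\<And>k. nth_el Y k \<le> nth_el X j \<Longrightarrow> k \<le> nth_el X j"
      using ge[OF assms(2)] order_trans by blast
    have le: "nth_el Y k \<le> nth_el X j"
      unfolding k_def by (rule GreatestI_nat[of _ 0 "nth_el X j"]) (use 0 bound in auto)
    have lt: "nth_el X j < nth_el Y (Suc k)"
    proof (rule ccontr)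
      assume "\<not> ?thesis"
      then have "Suc k \<le> k"
        unfolding k_def by (intro Greatest_le_nat[where b = "nth_el X j"]) (use bound in auto)
      then show False by simp
    qed
    have "nth_el Y K \<le> nth_el X j" using ge[OF assms(1), of j] j by linarith
    then have "K \<le> k"
      unfolding k_def by (intro Greatest_le_nat[where b = "nth_el X j"]) (use bound in auto)
    have Mj: "M \<le> nth_el X j" using ge[OF assms(1), of j] j by linarith
    have inX: "nth_el Y i \<in> insert 0 X" if "nth_el X j < nth_el Y i" for i
      using nth_el_in[OF assms(2), of i] M[of "nth_el Y i"] that Mj by auto
    have a: "nth_el X (Suc j) \<le> nth_el Y (Suc k)"
      by (rule nth_el_Suc_le[OF assms(1) inX[OF lt] lt])
    have b: "nth_el Y (Suc k) < nth_el Y (Suc (Suc k))"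
      by (rule nth_el_less[OF assms(2)]) simp
    have c: "nth_el X j < nth_el Y (Suc (Suc k))" using b lt by linarith
    have "nth_el X (Suc (Suc j)) \<le> nth_el Y (Suc (Suc k))"
      by (rule nth_el_Suc_le[OF assms(1) inX[OF c]]) (use a b in linarith)
    with \<open>K \<le> k\<close> le show ?thesis by blast
  qed
  show "\<alpha> \<in> F_grp X"
    unfolding F_grp_iff[OF assms(1)]
  proof (intro conjI allI impI)
    show "cmod (\<alpha> i) = 1" for i
      using \<alpha> by (simp add: F_grp_iff[OF assms(2)])
  next
    fix e :: real assume "e > 0"
    then obtain K where K: "\<And>k i j. k \<ge> K \<Longrightarrow> i \<in> {nth_el Y k..<nth_el Y (Suc (Suc k))} \<Longrightarrow>
        j \<in> {nth_el Y k..<nth_el Y (Suc (Suc k))} \<Longrightarrow> cmod (\<alpha> i * cnj (\<alpha> j) - 1) \<le> e"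
      using \<alpha> unfolding F_grp_iff[OF assms(2)] eventually_sequentially by meson
    show "\<forall>\<^sub>F k in sequentially. \<forall>i\<in>{nth_el X k..<nth_el X (Suc (Suc k))}.
       \<forall>j\<in>{nth_el X k..<nth_el X (Suc (Suc k))}. cmod (\<alpha> i * cnj (\<alpha> j) - 1) \<le> e"
      unfolding eventually_sequentially
    proof (intro exI allI impI ballI)
      fix l i j assume l: "M + nth_el Y K \<le> l"
        and ij: "i \<in> {nth_el X l..<nth_el X (Suc (Suc l))}"
          "j \<in> {nth_el X l..<nth_el X (Suc (Suc l))}"
      obtain k where "k \<ge> K" "nth_el Y k \<le> nth_el X l"
        "nth_el X (Suc (Suc l)) \<le> nth_el Y (Suc (Suc k))"
        using key[OF l] by blast
      then show "cmod (\<alpha> i * cnj (\<alpha> j) - 1) \<le> e"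
        using ij by (intro K[of k]) auto
    qed
  qed
qed

lemma quot_map_coset:
  assumes "infinite X" "infinite Y" "Y \<subseteq>\<^sup>* X" "\<alpha> \<in> carrier torus"
  shows "quot_map Y X (F_grp Y #>\<^bsub>torus\<^esub> \<alpha>) = F_grp X #>\<^bsub>torus\<^esub> \<alpha>"
proof -
  interpret comm_group torus by (rule comm_group_torus)
  have X: "subgroup (F_grp X) torus" and Y: "subgroup (F_grp Y) torus"
    using subgroup_F_grp assms by auto
  have "F_grp X <#>\<^bsub>torus\<^esub> F_grp Y = F_grp X"
  proof
    show "F_grp X <#>\<^bsub>torus\<^esub> F_grp Y \<subseteq> F_grp X"
      using F_grp_mono[OF assms(1-3)] subgroup.m_closed[OF X] by (auto simp: set_mult_def)
    show "F_grp X \<subseteq> F_grp X <#>\<^bsub>torus\<^esub> F_grp Y"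
    proof
      fix \<beta> assume "\<beta> \<in> F_grp X"
      then have "\<beta> = \<beta> \<otimes>\<^bsub>torus\<^esub> \<one>\<^bsub>torus\<^esub>" "\<one>\<^bsub>torus\<^esub> \<in> F_grp Y"
        using subgroup.mem_carrier[OF X] subgroup.one_closed[OF Y] by auto
      with \<open>\<beta> \<in> F_grp X\<close> show "\<beta> \<in> F_grp X <#>\<^bsub>torus\<^esub> F_grp Y"
        unfolding set_mult_def by blast
    qed
  qed
  then show ?thesis
    using setmult_rcos_assoc[OF subgroup.subset[OF X] subgroup.subset[OF Y] assms(4)]
    by (simp add: quot_map_def)
qed

end

(* A sequence lies in F_X iff it oscillates little inside far-out double intervals of X. Two facts
   drive the proof. First, a countable coherent system of sequences can be glued into a single one.
   Second, a sequence that winds around the circle very slowly lies in countably many prescribed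
   groups F_X but not in F_Y for any sufficiently sparse Y. Domination supplies such a Y in U, so
   there is a cofinal family Y_xi (xi < omega_1) with, for each xi, some gamma_xi that lies in
   F_{Y_eta} for all eta < xi but not in F_{Y_xi}. A recursion of length omega_1 that glues the
   earlier choices and optionally multiplies by gamma_xi at stage xi gives distinct threads for
   distinct subsets of omega_1. The upper bound holds because a thread is determined by aleph_1
   cosets, each represented by a sequence of complex numbers. *)

theory Submission
  imports Defs "HOL-Library.Countable_Set_Type"
begin

section \<open>Membership in F_X as small oscillation on double intervals\<close>

text \<open>Two points, in this order, of one double interval
  \<open>interval X k \<union> interval X (Suc k)\<close>. Ordering the pair lets a bound on the
  left point alone say that the pair lies far out.\<close>

definition near :: "nat set \<Rightarrow> nat \<Rightarrow> nat \<Rightarrow> bool"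
  where "near X x y \<longleftrightarrow> x \<le> y \<and> (\<exists>k. nth_el X k \<le> x \<and> y < nth_el X (Suc (Suc k)))"

lemma near_subinterval:
  assumes "near X x y" "x \<le> x'" "x' \<le> y'" "y' \<le> y"
  shows "near X x' y'"
  using assms unfolding near_def by (meson order_trans le_less_trans)

lemma nth_el_ge:
  assumes "infinite X"
  shows "j \<le> nth_el X j"
  unfolding nth_el_def by (rule le_enumerate) (use assms in simp)

lemma nth_el_0: "nth_el X 0 = 0"
  by (simp add: nth_el_def enumerate_0 Least_eq_0)

lemma nth_el_le_imp_le:
  assumes "infinite X" "nth_el X i < nth_el X j"
  shows "i < j"
  using assms nth_el_less[of X j i] by (cases i j rule: linorder_cases) auto

text \<open>Multiplication by \<open>cnj w\<close> is an isometry that takes \<open>w\<close> to 1.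
  This turns the multiplicative expression in \<open>Delta\<close> into an ordinary
  distance.\<close>

lemma cmod_mult_cnj_minus_one:
  assumes "cmod w = 1"
  shows "cmod (z * cnj w - 1) = cmod (z - w)"
proof -
  have "w * cnj w = 1"
    using assms by (simp add: complex_norm_square[symmetric])
  then have "z * cnj w - 1 = (z - w) * cnj w"
    by (simp add: algebra_simps)
  then show ?thesis
    using assms by (simp add: norm_mult)
qed

text \<open>Interval indices and positions tend to infinity together, so "for all late intervals"
  may be replaced by "for all pairs beyond some position". Such a threshold no longer mentions the
  enumeration of \<open>X\<close>, so thresholds for different sets can be compared.\<close>

lemma F_grp_iff_near:
  assumes "infinite X"
  shows "\<alpha> \<in> F_grp X \<longleftrightarrow> (\<forall>x. cmod (\<alpha> x) = 1) \<and>
    (\<forall>e>0. \<exists>M. \<forall>x y. M \<le> x \<longrightarrow> near X x y \<longrightarrow> cmod (\<alpha> x - \<alpha> y) \<le> e)"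
proof (cases "\<forall>x. cmod (\<alpha> x) = 1")
  case True
  define J where "J k = {nth_el X k..<nth_el X (Suc (Suc k))}" for k
  have "(\<forall>\<^sub>F k in sequentially. \<forall>x\<in>J k. \<forall>y\<in>J k. cmod (\<alpha> x - \<alpha> y) \<le> e) \<longleftrightarrow>
      (\<exists>M. \<forall>x y. M \<le> x \<longrightarrow> near X x y \<longrightarrow> cmod (\<alpha> x - \<alpha> y) \<le> e)" for e
  proof
    assume "\<forall>\<^sub>F k in sequentially. \<forall>x\<in>J k. \<forall>y\<in>J k. cmod (\<alpha> x - \<alpha> y) \<le> e"
    then obtain K where K: "\<And>k x y. K \<le> k \<Longrightarrow> x \<in> J k \<Longrightarrow> y \<in> J k \<Longrightarrow> cmod (\<alpha> x - \<alpha> y) \<le> e"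
      unfolding eventually_sequentially by blast
    \<comment> \<open>The threshold has index \<open>K + 2\<close> because the position of
      \<open>x\<close> bounds \<open>k\<close> from below only through the right end
      \<open>nth_el X (k + 2)\<close> of its double interval.\<close>
    have "cmod (\<alpha> x - \<alpha> y) \<le> e" if x: "nth_el X (Suc (Suc K)) \<le> x" and n: "near X x y" for x y
    proof -
      obtain k where k: "nth_el X k \<le> x" "x \<le> y" "y < nth_el X (Suc (Suc k))"
        using n by (auto simp: near_def)
      then have "nth_el X (Suc (Suc K)) < nth_el X (Suc (Suc k))"
        using x by linarith
      then have "K \<le> k"
        using nth_el_le_imp_le[OF assms] by fastforce
      then show ?thesis
        using k by (intro K[of k]) (auto simp: J_def)
    qed
    then show "\<exists>M. \<forall>x y. M \<le> x \<longrightarrow> near X x y \<longrightarrow> cmod (\<alpha> x - \<alpha> y) \<le> e"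
      by blast
  next
    assume "\<exists>M. \<forall>x y. M \<le> x \<longrightarrow> near X x y \<longrightarrow> cmod (\<alpha> x - \<alpha> y) \<le> e"
    then obtain M where M: "\<And>x y. M \<le> x \<Longrightarrow> near X x y \<Longrightarrow> cmod (\<alpha> x - \<alpha> y) \<le> e"
      by blast
    have "cmod (\<alpha> x - \<alpha> y) \<le> e" if "M \<le> k" "x \<in> J k" "y \<in> J k" for k x y
    proof -
      have "M \<le> x" "M \<le> y"
        using that nth_el_ge[OF assms, of k] by (auto simp: J_def)
      moreover have "near X x y \<or> near X y x"
        using that by (auto simp: J_def near_def)
      ultimately show ?thesis
        using M norm_minus_commute by metis
    qed
    then show "\<forall>\<^sub>F k in sequentially. \<forall>x\<in>J k. \<forall>y\<in>J k. cmod (\<alpha> x - \<alpha> y) \<le> e"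
      unfolding eventually_sequentially by blast
  qed
  then show ?thesis
    using True by (simp add: F_grp_iff[OF assms] cmod_mult_cnj_minus_one J_def)
qed (use assms in \<open>auto simp: F_grp_iff\<close>)

section \<open>Group operations and congruence modulo F_X\<close>

lemma F_grp_cmod:
  assumes "\<alpha> \<in> F_grp X"
  shows "cmod (\<alpha> x) = 1"
  using assms by (simp add: F_grp_def carrier_torus)

lemma F_grp_mult:
  assumes "infinite X" "\<alpha> \<in> F_grp X" "\<beta> \<in> F_grp X"
  shows "(\<lambda>x. \<alpha> x * \<beta> x) \<in> F_grp X"
  using subgroup.m_closed[OF subgroup_F_grp] assms by (fastforce simp: mult_torus)

lemma inv_torus:
  assumes "\<And>x. cmod (\<alpha> x) = 1"
  shows "inv\<^bsub>torus\<^esub> \<alpha> = (\<lambda>x. inverse (\<alpha> x))"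
proof -
  interpret comm_group torus by (rule comm_group_torus)
  have "\<alpha> x \<noteq> 0" for x
    using assms[of x] by auto
  then show ?thesis
    using assms by (intro inv_equality) (auto simp: mult_torus one_torus carrier_torus norm_inverse)
qed

lemma F_grp_inverse:
  assumes "infinite X" "\<alpha> \<in> F_grp X"
  shows "(\<lambda>x. inverse (\<alpha> x)) \<in> F_grp X"
  using subgroup.m_inv_closed[OF subgroup_F_grp[OF assms(1)] assms(2)]
  by (simp add: inv_torus F_grp_cmod[OF assms(2)])

lemma F_grp_divide:
  assumes "infinite X" "\<alpha> \<in> F_grp X" "\<beta> \<in> F_grp X"
  shows "(\<lambda>x. \<alpha> x / \<beta> x) \<in> F_grp X"
  using F_grp_mult[OF assms(1,2) F_grp_inverse[OF assms(1,3)]] by (simp add: divide_inverse)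

text \<open>The middle term cancels: \<beta> has no zeros because its ratio to \<gamma> has modulus
  1. Congruence modulo F_X is expressed throughout by such ratios, and this is its
  transitivity.\<close>

lemma F_grp_divide_trans:
  assumes "infinite X" "(\<lambda>x. \<alpha> x / \<beta> x) \<in> F_grp X" "(\<lambda>x. \<beta> x / \<gamma> x) \<in> F_grp X"
  shows "(\<lambda>x. \<alpha> x / \<gamma> x) \<in> F_grp X"
proof -
  have "\<beta> x \<noteq> 0" for x
    using F_grp_cmod[OF assms(3), of x] by auto
  then show ?thesis
    using F_grp_mult[OF assms] by simp
qed

text \<open>There is no oscillation at all beyond \<open>M\<close>, and only far-out pairs count.
  Both reflexivity of the congruence and changes of a sequence on a finite set are handled this
  way.\<close>

lemma F_grp_eventually_const:
  assumes "infinite X" "\<And>x. cmod (\<alpha> x) = 1" "\<And>x. M \<le> x \<Longrightarrow> \<alpha> x = c"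
  shows "\<alpha> \<in> F_grp X"
  unfolding F_grp_iff_near[OF assms(1)]
proof (intro conjI allI impI exI)
  fix e :: real and x y assume "0 < e" "M \<le> x" "near X x y"
  then show "cmod (\<alpha> x - \<alpha> y) \<le> e"
    using assms(3)[of x] assms(3)[of y] by (simp add: near_def)
qed (use assms in auto)

section \<open>Gluing a coherent sequence into one element of the torus\<close>

lemma cmod_mult_diff_le:
  assumes "cmod b = 1" "cmod c = 1"
  shows "cmod (a * b - c * d) \<le> cmod (a - c) + cmod (b - d)"
proof -
  have "a * b - c * d = (a - c) * b + c * (b - d)"
    by (simp add: algebra_simps)
  also have "cmod \<dots> \<le> cmod ((a - c) * b) + cmod (c * (b - d))"
    by (rule norm_triangle_ineq)
  finally show ?thesis
    using assms by (simp add: norm_mult)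
qed

text \<open>In the factorisation of \<alpha> as (\<alpha>/\<beta>) times \<beta>, the first factor
  oscillates by at most e/2 on all double intervals and the second does so far enough out. Thus F_X
  is closed under approximation that is uniform in this sense.\<close>

lemma F_grp_approx:
  assumes X: "infinite X" and \<alpha>: "\<And>x. cmod (\<alpha> x) = 1"
    and approx: "\<And>e. 0 < e \<Longrightarrow> \<exists>\<beta>\<in>F_grp X. \<forall>x y. near X x y \<longrightarrow>
      cmod (\<alpha> x / \<beta> x - \<alpha> y / \<beta> y) \<le> e"
  shows "\<alpha> \<in> F_grp X"
  unfolding F_grp_iff_near[OF X]
proof (intro conjI allI impI)
  fix e :: real assume "0 < e"
  then obtain \<beta> where \<beta>: "\<beta> \<in> F_grp X"
    and close: "\<And>x y. near X x y \<Longrightarrow> cmod (\<alpha> x / \<beta> x - \<alpha> y / \<beta> y) \<le> e / 2"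
    using approx[of "e / 2"] by auto
  have 1: "cmod (\<beta> x) = 1" for x
    using F_grp_cmod[OF \<beta>] .
  then have 0: "\<beta> x \<noteq> 0" for x
    by (metis norm_zero zero_neq_one)
  obtain M where M: "\<And>x y. M \<le> x \<Longrightarrow> near X x y \<Longrightarrow> cmod (\<beta> x - \<beta> y) \<le> e / 2"
    using \<beta> \<open>0 < e\<close> unfolding F_grp_iff_near[OF X] by (meson half_gt_zero)
  have "cmod (\<alpha> x - \<alpha> y) \<le> e" if "M \<le> x" "near X x y" for x y
  proof -
    have "cmod (\<alpha> x - \<alpha> y) = cmod (\<alpha> x / \<beta> x * \<beta> x - \<alpha> y / \<beta> y * \<beta> y)"
      using 0 by simp
    also have "\<dots> \<le> cmod (\<alpha> x / \<beta> x - \<alpha> y / \<beta> y) + cmod (\<beta> x - \<beta> y)"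
      by (rule cmod_mult_diff_le) (simp_all add: 1 \<alpha> norm_divide)
    also have "\<dots> \<le> e"
      using close[OF that(2)] M[OF that] by linarith
    finally show ?thesis .
  qed
  then show "\<exists>M. \<forall>x y. M \<le> x \<longrightarrow> near X x y \<longrightarrow> cmod (\<alpha> x - \<alpha> y) \<le> e"
    by blast
qed (rule \<alpha>)

text \<open>The correction \<open>b p = a (p + 1) / a p\<close> is switched on only from a large position \<open>m p\<close> on and
  normalised there, which costs nothing modulo \<open>F_grp\<close> and makes the corrections so flat that
  infinitely many of them can be multiplied.\<close>

lemma F_grp_sequence_limit:
  fixes Z :: "nat \<Rightarrow> nat set" and a :: "nat \<Rightarrow> nat \<Rightarrow> complex"
  assumes Z: "\<And>i. infinite (Z i)" and a: "\<And>n x. cmod (a n x) = 1"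
    and step: "\<And>i n. i \<le> n \<Longrightarrow> (\<lambda>x. a (Suc n) x / a n x) \<in> F_grp (Z i)"
  obtains \<alpha> where "\<And>x. cmod (\<alpha> x) = 1" "\<And>i. (\<lambda>x. \<alpha> x / a i x) \<in> F_grp (Z i)"
proof -
  have a0: "a n x \<noteq> 0" for n x
    using a[of n x] by auto
  define b where "b p x = a (Suc p) x / a p x" for p x
  have b: "cmod (b p x) = 1" for p x
    by (simp add: b_def norm_divide a)
  then have b0: "b p x \<noteq> 0" for p x
    by (metis norm_zero zero_neq_one)
  have "\<exists>m\<ge>p. \<forall>i\<le>p. \<forall>x y. m \<le> x \<longrightarrow> near (Z i) x y \<longrightarrow> cmod (b p x - b p y) \<le> (1/2) ^ p" for p
  proof -
    have "\<exists>M. \<forall>x y. M \<le> x \<longrightarrow> near (Z i) x y \<longrightarrow> cmod (b p x - b p y) \<le> (1/2) ^ p" if "i \<le> p" for i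
      using step[OF that] unfolding F_grp_iff_near[OF Z] b_def by simp
    then obtain M where M: "\<And>i x y. i \<le> p \<Longrightarrow> M i \<le> x \<Longrightarrow> near (Z i) x y \<Longrightarrow>
        cmod (b p x - b p y) \<le> (1/2) ^ p"
      by metis
    \<comment> \<open>The sum is a common upper bound for the finitely many thresholds
      \<open>M i\<close>; the extra \<open>p\<close> secures \<open>p \<le> m p\<close>.\<close>
    have "M i \<le> (\<Sum>i\<le>p. M i) + p" if "i \<le> p" for i
      using that by (intro trans_le_add1 member_le_sum) auto
    then show ?thesis
      by (intro exI[of _ "(\<Sum>i\<le>p. M i) + p"]) (use M order_trans in fastforce)
  qed
  then obtain m where m_ge: "\<And>p. p \<le> m p" and m: "\<And>p i x y. i \<le> p \<Longrightarrow> m p \<le> x \<Longrightarrow>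
      near (Z i) x y \<Longrightarrow> cmod (b p x - b p y) \<le> (1/2) ^ p"
    by metis
  define b' where "b' p x = b p (max x (m p)) / b p (m p)" for p x
  have b': "cmod (b' p x) = 1" for p x
    by (simp add: b'_def norm_divide b)
  \<comment> \<open>At a given \<open>x\<close> only the factors with \<open>p < x\<close> can
    differ from 1, so the infinite product of the \<open>b' p\<close> is finite at every
    point.\<close>
  have b'_1: "b' p x = 1" if "x \<le> p" for p x
    using that m_ge[of p] b0 by (simp add: b'_def max_absorb2)
  \<comment> \<open>Clamping at \<open>m p\<close> extends the bound to all near pairs: either the
    clamped pair stays inside the same double interval, or both points clamp to \<open>m p\<close>
    and the difference vanishes.\<close>
  have osc: "cmod (b' p x - b' p y) \<le> (1/2) ^ p" if "i \<le> p" "near (Z i) x y" for i p x y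
  proof -
    have "cmod (b' p x - b' p y) = cmod (b p (max x (m p)) - b p (max y (m p)))"
      by (simp add: b'_def b norm_divide flip: diff_divide_distrib)
    also have "\<dots> \<le> (1/2) ^ p"
    proof (cases "m p \<le> y")
      case True
      then have "near (Z i) (max x (m p)) (max y (m p))"
        using that(2) by (intro near_subinterval[OF that(2)]) (auto simp: near_def)
      then show ?thesis
        by (intro m[OF that(1)]) auto
    next
      case False
      then show ?thesis
        using that(2) by (simp add: near_def max_def)
    qed
    finally show ?thesis .
  qed
  define T where "T Q x = a 0 x * (\<Prod>p<Q. b' p x)" for Q x
  have T: "cmod (T Q x) = 1" for Q x
    by (simp add: T_def norm_mult a b' flip: prod_norm)
  \<comment> \<open>Beyond all \<open>m p\<close> with \<open>p < Q\<close> the product telescopes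
    to \<open>a Q\<close> up to the constants \<open>b p (m p)\<close>. The ratio is therefore
    eventually constant and lies in the group of every \<open>Z i\<close>.\<close>
  have T_a: "(\<lambda>x. T Q x / a Q x) \<in> F_grp (Z i)" for Q i
  proof (rule F_grp_eventually_const[OF Z])
    have aQ: "a Q x = a 0 x * (\<Prod>p<Q. b p x)" for x
      by (induction Q) (use a0 in \<open>simp_all add: b_def field_simps\<close>)
    show "T Q x / a Q x = (\<Prod>p<Q. inverse (b p (m p)))" if "(\<Sum>p<Q. m p) \<le> x" for x
    proof -
      have "b' p x = inverse (b p (m p)) * b p x" if "p < Q" for p
      proof -
        have "m p \<le> (\<Sum>p<Q. m p)"
          using that by (intro member_le_sum) auto
        with \<open>_ \<le> x\<close> show ?thesis
          by (simp add: b'_def max_absorb1 divide_inverse)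
      qed
      then have "(\<Prod>p<Q. b' p x) = (\<Prod>p<Q. inverse (b p (m p))) * (\<Prod>p<Q. b p x)"
        by (simp flip: prod.distrib)
      then show ?thesis
        using a0[of 0 x] b0 by (simp add: T_def aQ)
    qed
  qed (simp add: norm_divide T a)
  \<comment> \<open>Cutting the product off at \<open>x\<close> itself loses nothing, since all
    later factors are 1 at \<open>x\<close>.\<close>
  define \<alpha> where "\<alpha> x = T x x" for x
  have \<alpha>_T: "\<alpha> x = T Q x * (\<Prod>p\<in>{Q..<R}. b' p x)" if "x \<le> R" "Q \<le> R" for x Q R
  proof -
    have "(\<Prod>p<R. b' p x) = (\<Prod>p<x. b' p x) * (\<Prod>p\<in>{x..<R}. b' p x)"
      using that(1) by (simp add: lessThan_atLeast0 prod.atLeastLessThan_concat)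
    also have "(\<Prod>p\<in>{x..<R}. b' p x) = 1"
      by (rule prod.neutral) (simp add: b'_1)
    finally have "(\<Prod>p<x. b' p x) = (\<Prod>p<Q. b' p x) * (\<Prod>p\<in>{Q..<R}. b' p x)"
      using that(2) by (simp add: lessThan_atLeast0 prod.atLeastLessThan_concat)
    then show ?thesis
      by (simp add: \<alpha>_def T_def)
  qed
  show ?thesis
  proof (rule that)
    show \<alpha>: "cmod (\<alpha> x) = 1" for x
      by (simp add: \<alpha>_def T)
    show "(\<lambda>x. \<alpha> x / a i x) \<in> F_grp (Z i)" for i
    proof (rule F_grp_approx[OF Z])
      fix e :: real assume "0 < e"
      \<comment> \<open>The oscillations of the factors from \<open>Q\<close> on form a geometric
        tail of size at most \<open>2 * (1/2) ^ Q\<close>, hence the bound e/2. Taking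
        \<open>Q\<close> at least \<open>i\<close> makes \<open>osc\<close> applicable to
        \<open>Z i\<close>.\<close>
      then obtain Q0 where Q0: "(1/2) ^ Q0 < e / 2"
        using real_arch_pow_inv[of "e / 2" "1/2"] by auto
      define Q where "Q = max Q0 i"
      have "(1/2 :: real) ^ Q \<le> (1/2) ^ Q0"
        by (rule power_decreasing) (simp_all add: Q_def)
      then have Q: "(1/2) ^ Q < e / 2"
        using Q0 by (rule le_less_trans)
      have i_le_Q: "i \<le> Q"
        by (simp add: Q_def)
      have a_a: "(\<lambda>x. a n x / a i x) \<in> F_grp (Z i)" if "i \<le> n" for n
        using that
      proof (induction n rule: dec_induct)
        case base
        show ?case
          by (rule F_grp_eventually_const[OF Z, of _ 0 1]) (simp_all add: a0)
      next
        case (step n)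
        then show ?case
          using F_grp_divide_trans[OF Z assms(3)] by blast
      qed
      show "\<exists>\<beta>\<in>F_grp (Z i). \<forall>x y. near (Z i) x y \<longrightarrow>
          cmod (\<alpha> x / a i x / \<beta> x - \<alpha> y / a i y / \<beta> y) \<le> e"
      proof (intro bexI allI impI)
        show "(\<lambda>x. T Q x / a i x) \<in> F_grp (Z i)"
          by (rule F_grp_divide_trans[OF Z T_a a_a[OF i_le_Q]])
        fix x y assume xy: "near (Z i) x y"
        \<comment> \<open>A cut-off beyond \<open>x\<close>, \<open>y\<close> and \<open>Q\<close>
          represents the values of \<alpha> at both points by products over the same index
          range.\<close>
        define R where "R = y + Q"
        have R: "x \<le> R" "y \<le> R" "Q \<le> R"
          using xy by (auto simp: R_def near_def)
        have T0: "T Q x \<noteq> 0" for x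
          using T[of Q x] by auto
        have *: "\<alpha> z / a i z / (T Q z / a i z) = (\<Prod>p\<in>{Q..<R}. b' p z)" if "z \<le> R" for z
          using \<alpha>_T[OF that R(3)] a0 T0 by (simp add: field_simps)
        have "cmod ((\<Prod>p\<in>{Q..<R}. b' p x) - (\<Prod>p\<in>{Q..<R}. b' p y))
            \<le> (\<Sum>p\<in>{Q..<R}. cmod (b' p x - b' p y))"
          by (rule norm_prod_diff) (simp_all add: b')
        also have "\<dots> \<le> (\<Sum>p\<in>{Q..<R}. (1/2) ^ p)"
          using osc[OF _ xy] i_le_Q by (intro sum_mono) auto
        also have "\<dots> = 2 * (1/2) ^ Q - 2 * (1/2) ^ R"
          using R(3) by (induction R rule: dec_induct) simp_all
        also have "\<dots> \<le> e"
          using Q zero_le_power[of "1/2 :: real" R] by linarith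
        finally show "cmod (\<alpha> x / a i x / (T Q x / a i x) - \<alpha> y / a i y / (T Q y / a i y)) \<le> e"
          using * R by simp
      qed
    qed (simp add: norm_divide \<alpha> a)
  qed
qed

section \<open>Slowly winding sequences that escape sparse sets\<close>

text \<open>\<open>c x\<close> is the number of the block cut out by \<open>m\<close> that contains
  \<open>x\<close>. By \<open>sep\<close>, a near pair far enough out meets one block or two
  consecutive ones, so the sequence changes by at most one increment of \<open>s\<close>, and these
  increments tend to 0.\<close>

lemma F_grp_slow:
  fixes m :: "nat \<Rightarrow> nat"
  defines "c \<equiv> \<lambda>x. LEAST n. x < m n"
  assumes X: "infinite X" and m: "strict_mono m"
    and sep: "\<And>n x y. i \<le> n \<Longrightarrow> near X x y \<Longrightarrow> x < m n \<Longrightarrow> y < m (Suc n)"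
    and s: "\<And>n. cmod (s n) = 1" "(\<lambda>n. s n - s (Suc n)) \<longlonglongrightarrow> 0"
  shows "(\<lambda>x. s (c x)) \<in> F_grp X"
  unfolding F_grp_iff_near[OF X]
proof (intro conjI allI impI)
  fix e :: real assume "0 < e"
  then obtain N where N: "\<And>n. N \<le> n \<Longrightarrow> cmod (s n - s (Suc n)) < e"
    using LIMSEQ_D[OF s(2)] by fastforce
  have less_c: "x < m (c x)" for x
    unfolding c_def by (rule LeastI[of _ "Suc x"]) (use m strict_mono_imp_increasing[of m "Suc x"] in simp)
  have c_le: "c x \<le> n" if "x < m n" for x n
    unfolding c_def using that by (rule Least_le)
  \<comment> \<open>Beyond \<open>m (N + i)\<close> the block number exceeds both \<open>N\<close>,
    which makes the increment small, and \<open>i\<close>, which makes \<open>sep\<close>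
    applicable.\<close>
  have "cmod (s (c x) - s (c y)) \<le> e" if x: "m (N + i) \<le> x" and n: "near X x y" for x y
  proof -
    have "N + i \<le> c x"
      using x less_c[of x] m by (metis le_less_trans less_imp_le strict_mono_less)
    then have "y < m (Suc (c x))"
      using sep[OF _ n less_c] by simp
    then have "c y \<le> Suc (c x)"
      by (rule c_le)
    moreover have "c x \<le> c y"
      using n less_c[of y] by (intro c_le) (auto simp: near_def)
    ultimately have "c y = c x \<or> c y = Suc (c x)"
      by linarith
    then show ?thesis
      using N[of "c x"] \<open>N + i \<le> c x\<close> \<open>0 < e\<close> by (auto intro: less_imp_le)
  qed
  then show "\<exists>M. \<forall>x y. M \<le> x \<longrightarrow> near X x y \<longrightarrow> cmod (s (c x) - s (c y)) \<le> e"
    by blast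
qed (rule s)

text \<open>The angle grows by \<open>pi * log 2 ((n + 1) / n)\<close>, which tends to 0, although
  the angle itself is unbounded. The argument is carried out for \<open>Suc n\<close> to keep the
  logarithms away from 0.\<close>

lemma cis_log_slow: "(\<lambda>n. cis (pi * log 2 (real n)) - cis (pi * log 2 (real (Suc n)))) \<longlonglongrightarrow> 0"
proof -
  have "(\<lambda>n. log 2 (real (Suc (Suc n)) / real (Suc n))) \<longlonglongrightarrow> log 2 1"
    by (rule tendsto_log[OF tendsto_const LIMSEQ_Suc[OF LIMSEQ_Suc_n_over_n]]) auto
  then have "(\<lambda>n. cis (pi * log 2 (real (Suc (Suc n)) / real (Suc n)))) \<longlonglongrightarrow> cis (pi * log 2 1)"
    by (intro tendsto_cis tendsto_mult tendsto_const)
  then have "(\<lambda>n. cmod (1 - cis (pi * log 2 (real (Suc (Suc n)) / real (Suc n))))) \<longlonglongrightarrow> cmod (1 - 1)"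
    by (intro tendsto_norm tendsto_diff tendsto_const) simp
  also have "(\<lambda>n. cmod (1 - cis (pi * log 2 (real (Suc (Suc n)) / real (Suc n)))))
      = (\<lambda>n. cmod (cis (pi * log 2 (real (Suc n))) - cis (pi * log 2 (real (Suc (Suc n))))))"
  proof
    fix n
    let ?a = "pi * log 2 (real (Suc n))" and ?b = "pi * log 2 (real (Suc (Suc n)))"
    have "pi * log 2 (real (Suc (Suc n)) / real (Suc n)) = ?b - ?a"
      by (simp add: log_divide right_diff_distrib)
    moreover have "cis ?a - cis ?b = cis ?a * (1 - cis (?b - ?a))"
      by (simp add: right_diff_distrib cis_mult)
    ultimately show "cmod (1 - cis (pi * log 2 (real (Suc (Suc n)) / real (Suc n)))) = cmod (cis ?a - cis ?b)"
      by (simp add: norm_mult)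
  qed
  finally show ?thesis
    by (intro LIMSEQ_imp_Suc[of "\<lambda>n. cis (pi * log 2 (real n)) - cis (pi * log 2 (real (Suc n)))"])
      (simp add: tendsto_norm_zero_iff)
qed

text \<open>The sequence \<open>\<gamma>\<close> winds around the circle so slowly that no interval of a set in \<open>C\<close> sees it
  move. If \<open>Y\<close> is sparse, then infinitely many of its intervals contain half a turn.\<close>

lemma F_grp_countable_escape:
  assumes "countable C" and C: "\<And>X. X \<in> C \<Longrightarrow> infinite X"
  obtains \<gamma> f where "\<And>x. cmod (\<gamma> x) = 1" "\<And>X. X \<in> C \<Longrightarrow> \<gamma> \<in> F_grp X"
    "\<And>Y. infinite Y \<Longrightarrow> \<forall>\<^sub>\<infinity>i. f i \<le> nth_el Y i \<Longrightarrow> \<gamma> \<notin> F_grp Y"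
proof -
  \<comment> \<open>Inserting the infinite set \<open>UNIV\<close> makes the family nonempty, so it
    can be enumerated even when \<open>C\<close> is empty.\<close>
  define Z where "Z = from_nat_into (insert UNIV C)"
  have Z_range: "range Z = insert UNIV C"
    unfolding Z_def using assms(1) by (intro range_from_nat_into) auto
  then have Z: "infinite (Z i)" for i
    using C by (metis insertE infinite_UNIV_nat rangeI)
  \<comment> \<open>A double interval of \<open>Z i\<close> that contains a point below
    \<open>M\<close> has index below \<open>M\<close>, since \<open>k \<le> nth_el (Z i) k\<close>.
    Hence it ends before \<open>nth_el (Z i) (M + 2)\<close>, and the next value of \<open>m\<close>
    is put beyond this for all \<open>i \<le> n\<close>.\<close>
  define m where "m = rec_nat 0 (\<lambda>n M. M + 1 + (\<Sum>i\<le>n. nth_el (Z i) (Suc (Suc M))))"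
  have m_Suc: "m (Suc n) = m n + 1 + (\<Sum>i\<le>n. nth_el (Z i) (Suc (Suc (m n))))" for n
    by (simp add: m_def)
  have m: "strict_mono m"
    by (simp add: strict_mono_Suc_iff m_Suc)
  have sep: "y < m (Suc n)" if i: "i \<le> n" and xy: "near (Z i) x y" "x < m n" for i n x y
  proof -
    obtain k where k: "nth_el (Z i) k \<le> x" "y < nth_el (Z i) (Suc (Suc k))"
      using xy(1) by (auto simp: near_def)
    have "k < m n"
      using k(1) nth_el_ge[OF Z, of k i] xy(2) by linarith
    then have "nth_el (Z i) (Suc (Suc k)) < nth_el (Z i) (Suc (Suc (m n)))"
      by (intro nth_el_less[OF Z]) simp
    also have "\<dots> \<le> (\<Sum>i\<le>n. nth_el (Z i) (Suc (Suc (m n))))"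
      using i by (intro member_le_sum) auto
    finally show ?thesis
      using k(2) by (simp add: m_Suc)
  qed
  define s where "s n = cis (pi * log 2 (real n))" for n
  define \<gamma> where "\<gamma> x = s (LEAST n. x < m n)" for x
  \<comment> \<open>This is the first position of block number \<open>2 ^ t\<close>, where the
    logarithm is \<open>t\<close> and the angle is \<open>t\<close> half turns.\<close>
  define p where "p t = m (2 ^ t - 1)" for t
  have p: "strict_mono p"
  proof (rule strict_monoI)
    fix t u :: nat assume "t < u"
    then have "(2::nat) ^ t - 1 < 2 ^ u - 1"
      by (intro diff_less_mono) simp_all
    then show "p t < p u"
      unfolding p_def using m strict_mono_less by blast
  qed
  have \<gamma>_p: "\<gamma> (p t) = (- 1) ^ t" for t
  proof -
    have "(LEAST n. m (2 ^ t - 1) < m n) = 2 ^ t"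
    proof (rule Least_equality)
      show "m (2 ^ t - 1) < m (2 ^ t)"
        using m by (simp add: strict_mono_less)
      show "2 ^ t \<le> n" if "m (2 ^ t - 1) < m n" for n
        using that m by (simp add: strict_mono_less)
    qed
    then have "\<gamma> (p t) = cis (pi * real t)"
      by (simp add: \<gamma>_def p_def s_def log_nat_power)
    also have "\<dots> = (- 1) ^ t"
      by (metis Complex.DeMoivre cis_pi mult.commute)
    finally show ?thesis .
  qed
  show ?thesis
  proof (rule that)
    show "cmod (\<gamma> x) = 1" for x
      by (simp add: \<gamma>_def s_def)
    show "\<gamma> \<in> F_grp X" if X: "X \<in> C" for X
    proof -
      obtain i where "X = Z i"
        using Z_range X by blast
      moreover have "(\<lambda>x. s (LEAST n. x < m n)) \<in> F_grp (Z i)"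
      proof (rule F_grp_slow[OF Z m])
        show "y < m (Suc n)" if "i \<le> n" "near (Z i) x y" "x < m n" for n x y
          using sep[OF that] .
        show "cmod (s n) = 1" for n
          by (simp add: s_def)
        show "(\<lambda>n. s n - s (Suc n)) \<longlonglongrightarrow> 0"
          unfolding s_def by (rule cis_log_slow)
      qed
      ultimately show ?thesis
        unfolding \<gamma>_def by simp
    qed
    \<comment> \<open>The escape function is \<open>Suc (p (2 * i))\<close>. If \<gamma> were in
      \<open>F_grp Y\<close>, then \<open>Y\<close> would meet every gap between consecutive values
      of \<open>p\<close> from \<open>M\<close> on, so its \<open>n\<close>-th element would be at
      most \<open>p (M + n)\<close>. For large \<open>n\<close> this contradicts domination.\<close>
    fix Y :: "nat set"
    assume Y: "infinite Y" and dom: "\<forall>\<^sub>\<infinity>i. Suc (p (2 * i)) \<le> nth_el Y i"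
    show "\<gamma> \<notin> F_grp Y"
    proof
      assume "\<gamma> \<in> F_grp Y"
      then obtain M where M: "\<And>x y. M \<le> x \<Longrightarrow> near Y x y \<Longrightarrow> cmod (\<gamma> x - \<gamma> y) \<le> 1"
        unfolding F_grp_iff_near[OF Y] using zero_less_one by blast
      \<comment> \<open>If \<open>Y\<close> missed the gap, one double interval would contain both
        \<open>p t\<close> and \<open>p (Suc t)\<close>, where \<gamma> takes opposite values at
        distance 2.\<close>
      have hit: "\<exists>k. nth_el Y k \<in> {p t<..p (Suc t)}" if t: "M \<le> t" for t
      proof (rule ccontr)
        assume none: "\<nexists>k. nth_el Y k \<in> {p t<..p (Suc t)}"
        define k where "k = (LEAST k. p t < nth_el Y k)"
        have k: "p t < nth_el Y k"
          unfolding k_def by (rule LeastI[of _ "Suc (p t)"]) (use nth_el_ge[OF Y, of "Suc (p t)"] in simp)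
        then obtain l where l: "k = Suc l"
          by (cases k) (simp_all add: nth_el_0)
        have "nth_el Y l \<le> p t"
          using not_less_Least[of l "\<lambda>k. p t < nth_el Y k"] l k_def by simp
        moreover have "p (Suc t) < nth_el Y (Suc l)"
          using none k l by force
        ultimately have "near Y (p t) (p (Suc t))"
          using strict_mono_less[OF p, of t "Suc t"] nth_el_less[OF Y, of "Suc l" "Suc (Suc l)"]
          unfolding near_def by (intro conjI exI[of _ l]) auto
        moreover have "M \<le> p t"
          using t strict_mono_imp_increasing[OF p, of t] by simp
        ultimately have "cmod (\<gamma> (p t) - \<gamma> (p (Suc t))) \<le> 1"
          by (intro M)
        moreover have "\<gamma> (p t) - \<gamma> (p (Suc t)) = 2 * (- 1) ^ t"
          by (simp add: \<gamma>_p)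
        ultimately show False
          by (simp add: norm_mult norm_power)
      qed
      have bound: "nth_el Y n \<le> p (M + n)" for n
      proof (induction n)
        case (Suc n)
        obtain k where k: "nth_el Y k \<in> {p (M + n)<..p (Suc (M + n))}"
          using hit[of "M + n"] by auto
        then have "nth_el Y n < nth_el Y k"
          using Suc.IH by simp
        then have "nth_el Y (Suc n) \<le> nth_el Y k"
          by (intro nth_el_Suc_le[OF Y nth_el_in[OF Y]])
        with k show ?case
          by simp
      qed (simp add: nth_el_0)
      obtain N where "\<And>i. N \<le> i \<Longrightarrow> Suc (p (2 * i)) \<le> nth_el Y i"
        using dom unfolding MOST_nat_le by blast
      then obtain i where "M \<le> i" "Suc (p (2 * i)) \<le> nth_el Y i"
        using max.cobounded1 max.cobounded2 by blast
      moreover have "p (M + i) \<le> p (2 * i)"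
        using \<open>M \<le> i\<close> by (simp add: strict_mono_less_eq[OF p])
      ultimately show False
        using bound[of i] by linarith
    qed
  qed
qed

section \<open>Transfinite recursion along omega_1\<close>

text \<open>The running maxima \<open>s\<close> of an enumeration \<open>e\<close> of
  \<open>A\<close> reduce the countable chain to a sequence: \<open>e i\<close> lies below
  \<open>s n\<close> whenever \<open>i \<le> n\<close>, so \<open>F_grp_sequence_limit\<close>
  applies. Its limit is congruent to \<open>\<beta> (s i)\<close> and hence to
  \<open>\<beta> (e i)\<close> modulo the group of \<open>Y (e i)\<close>.\<close>

lemma (in wo_rel) coherent_limit:
  fixes Y :: "'a \<Rightarrow> nat set" and \<beta> :: "'a \<Rightarrow> nat \<Rightarrow> complex"
  assumes A: "A \<subseteq> Field r" "countable A"
    and Y: "\<And>b. b \<in> A \<Longrightarrow> infinite (Y b)"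
    and \<beta>: "\<And>b x. b \<in> A \<Longrightarrow> cmod (\<beta> b x) = 1"
    and coh: "\<And>b c. b \<in> A \<Longrightarrow> c \<in> A \<Longrightarrow> (b, c) \<in> r \<Longrightarrow> (\<lambda>x. \<beta> c x / \<beta> b x) \<in> F_grp (Y b)"
  shows "\<exists>\<alpha>. (\<forall>x. cmod (\<alpha> x) = 1) \<and> (\<forall>b\<in>A. (\<lambda>x. \<alpha> x / \<beta> b x) \<in> F_grp (Y b))"
proof (cases "A = {}")
  case True
  then show ?thesis
    by (intro exI[of _ "\<lambda>_. 1"]) simp
next
  case False
  define e where "e = from_nat_into A"
  have e: "range e = A"
    unfolding e_def using False A(2) by (rule range_from_nat_into)
  then have eA: "e n \<in> A" for n
    by blast
  define s where "s = rec_nat (e 0) (\<lambda>n b. max2 b (e (Suc n)))"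
  have s_Suc: "s (Suc n) = max2 (s n) (e (Suc n))" for n
    by (simp add: s_def)
  have sA: "s n \<in> A" for n
  proof (induction n)
    case (Suc n)
    then show ?case
      using eA[of "Suc n"] by (auto simp: s_Suc max2_def)
  qed (simp add: s_def eA)
  have e_s: "(e i, s n) \<in> r" if "i \<le> n" for i n
    using that
  proof (induction n)
    case 0
    then show ?case
      using A(1) eA[of 0] REFL by (auto simp: s_def refl_on_def)
  next
    case (Suc n)
    have max: "(s n, s (Suc n)) \<in> r" "(e (Suc n), s (Suc n)) \<in> r"
      using max2_greater[of "s n" "e (Suc n)"] sA[of n] eA[of "Suc n"] A(1)
      by (auto simp: s_Suc)
    show ?case
      using Suc max TRANS by (cases "i = Suc n") (auto simp: trans_def dest: le_SucE)
  qed
  have s_e: "(\<lambda>x. \<beta> (s n) x / \<beta> (e i) x) \<in> F_grp (Y (e i))" if "i \<le> n" for i n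
    by (intro coh eA sA e_s that)
  have \<beta>0: "\<beta> b x \<noteq> 0" if "b \<in> A" for b x
    using \<beta>[OF that, of x] by auto
  obtain \<alpha> where \<alpha>: "\<And>x. cmod (\<alpha> x) = 1"
    "\<And>i. (\<lambda>x. \<alpha> x / \<beta> (s i) x) \<in> F_grp (Y (e i))"
  \<comment> \<open>The sets run along \<open>e\<close>, so that every \<open>Y b\<close> with
    \<open>b\<close> in \<open>A\<close> occurs; the sequences run along \<open>s\<close>, which is
    increasing.\<close>
  proof (rule F_grp_sequence_limit[of "\<lambda>i. Y (e i)" "\<lambda>n. \<beta> (s n)"])
    show "(\<lambda>x. \<beta> (s (Suc n)) x / \<beta> (s n) x) \<in> F_grp (Y (e i))" if i: "i \<le> n" for i n
      using F_grp_divide[OF Y[OF eA] s_e[of i "Suc n"] s_e[of i n]] i \<beta>0[OF eA] by simp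
  qed (use Y \<beta> eA sA in auto)
  have "(\<lambda>x. \<alpha> x / \<beta> (e i) x) \<in> F_grp (Y (e i))" for i
    using F_grp_divide_trans[OF Y[OF eA] \<alpha>(2) s_e] by simp
  with \<alpha>(1) e show ?thesis
    by (intro exI[of _ \<alpha>]) auto
qed

text \<open>A proper initial segment of a cardinal order has smaller cardinality, and smaller than
  the successor of \<open>natLeq\<close> means at most \<open>natLeq\<close>.\<close>

lemma countable_underS_aleph1:
  assumes "\<xi> \<in> Field aleph1"
  shows "countable (underS aleph1 \<xi>)"
  unfolding countable_card_le_natLeq
  by (rule iffD1[OF cardSuc_ordLeq_ordLess[OF natLeq_Card_order card_of_Card_order]])
    (rule card_of_underS[OF cardSuc_Card_order[OF natLeq_Card_order] assms])

interpretation aleph1: wo_rel aleph1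
  by unfold_locales
    (meson card_order_on_well_order_on cardSuc_Card_order natLeq_Card_order)

text \<open>At stage \<xi> only countably many sets have been chosen, so
  \<open>F_grp_countable_escape\<close> supplies a sequence lying in all their groups, and
  domination supplies a set of \<open>U\<close> whose group it avoids. Intersecting that set with
  \<open>Xs \<xi>\<close> preserves cofinality.\<close>

lemma cofinal_escaping_sets:
  assumes inf: "\<And>X. X \<in> U \<Longrightarrow> infinite X"
    and inter: "\<And>X Y. X \<in> U \<Longrightarrow> Y \<in> U \<Longrightarrow> X \<inter> Y \<in> U"
    and dominating: "\<And>f :: nat \<Rightarrow> nat. \<exists>X\<in>U. \<forall>\<^sub>\<infinity>i. f i \<le> nth_el X i"
    and Xs: "\<And>\<xi>. \<xi> \<in> Field aleph1 \<Longrightarrow> Xs \<xi> \<in> U"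
  obtains Y \<gamma> where "\<And>\<xi>. \<xi> \<in> Field aleph1 \<Longrightarrow> Y \<xi> \<in> U \<and> Y \<xi> \<subseteq> Xs \<xi>"
    "\<And>\<xi> x. \<xi> \<in> Field aleph1 \<Longrightarrow> cmod (\<gamma> \<xi> x) = 1"
    "\<And>\<xi> \<eta>. \<xi> \<in> Field aleph1 \<Longrightarrow> \<eta> \<in> underS aleph1 \<xi> \<Longrightarrow> \<gamma> \<xi> \<in> F_grp (Y \<eta>)"
    "\<And>\<xi>. \<xi> \<in> Field aleph1 \<Longrightarrow> \<gamma> \<xi> \<notin> F_grp (Y \<xi>)"
proof -
  \<comment> \<open>\<open>P\<close> demands nothing outside \<open>Field aleph1\<close>, because
    the well-founded recursion runs over the whole type \<open>nat set\<close>.\<close>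
  define P where "P Y\<gamma> \<xi> Z\<delta> \<longleftrightarrow> (\<xi> \<in> Field aleph1 \<longrightarrow>
    fst Z\<delta> \<in> U \<and> fst Z\<delta> \<subseteq> Xs \<xi> \<and> (\<forall>x. cmod (snd Z\<delta> x) = 1) \<and>
    (\<forall>\<eta>\<in>underS aleph1 \<xi>. snd Z\<delta> \<in> F_grp (fst (Y\<gamma> \<eta>))) \<and> snd Z\<delta> \<notin> F_grp (fst Z\<delta>))"
    for Y\<gamma> :: "nat set \<Rightarrow> nat set \<times> (nat \<Rightarrow> complex)" and \<xi> Z\<delta>
  have "\<exists>Y\<gamma>. \<forall>\<xi>. P Y\<gamma> \<xi> (Y\<gamma> \<xi>)"
  proof (rule dependent_wf_choice[OF aleph1.WF])
    show "P f \<xi> Z\<delta> = P g \<xi> Z\<delta>" if "\<And>\<eta>. (\<eta>, \<xi>) \<in> aleph1 - Id \<Longrightarrow> f \<eta> = g \<eta>" for f g \<xi> Z\<delta>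
      using that by (auto simp: P_def underS_def)
    show "\<exists>Z\<delta>. P Y\<gamma> \<xi> Z\<delta>" if IH: "\<And>\<eta>. (\<eta>, \<xi>) \<in> aleph1 - Id \<Longrightarrow> P Y\<gamma> \<eta> (Y\<gamma> \<eta>)" for Y\<gamma> \<xi>
    proof (cases "\<xi> \<in> Field aleph1")
      case True
      have YU: "fst (Y\<gamma> \<eta>) \<in> U" if "\<eta> \<in> underS aleph1 \<xi>" for \<eta>
        using IH[of \<eta>] that by (auto simp: P_def underS_def Field_def)
      let ?C = "(\<lambda>\<eta>. fst (Y\<gamma> \<eta>)) ` underS aleph1 \<xi>"
      obtain \<gamma> f where \<gamma>: "\<And>x. cmod (\<gamma> x) = 1" "\<And>X. X \<in> ?C \<Longrightarrow> \<gamma> \<in> F_grp X"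
        and f: "\<And>Y. infinite Y \<Longrightarrow> \<forall>\<^sub>\<infinity>i. f i \<le> nth_el Y i \<Longrightarrow> \<gamma> \<notin> F_grp Y"
      proof (rule F_grp_countable_escape[of ?C])
        show "countable ?C"
          using countable_underS_aleph1[OF True] by simp
      qed (use YU inf in blast)+
      obtain Z where Z: "Z \<in> U" "\<forall>\<^sub>\<infinity>i. f i \<le> nth_el Z i"
        using dominating by blast
      have ZX: "Z \<inter> Xs \<xi> \<in> U"
        using inter Z Xs True by blast
      \<comment> \<open>Domination is known for \<open>Z\<close>; the escape passes to the
        intersection because the smaller set has the smaller group.\<close>
      have "F_grp (Z \<inter> Xs \<xi>) \<subseteq> F_grp Z"
        by (intro F_grp_mono inf Z ZX) (simp add: almost_subset_def Diff_eq_empty_iff[THEN iffD2])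
      then have "P Y\<gamma> \<xi> (Z \<inter> Xs \<xi>, \<gamma>)"
        using \<gamma> f[OF inf Z(2)] Z ZX by (auto simp: P_def)
      then show ?thesis
        by blast
    qed (simp add: P_def)
  qed
  then obtain Y\<gamma> where "\<And>\<xi>. P Y\<gamma> \<xi> (Y\<gamma> \<xi>)"
    by blast
  then show ?thesis
    by (intro that[of "\<lambda>\<xi>. fst (Y\<gamma> \<xi>)" "\<lambda>\<xi>. snd (Y\<gamma> \<xi>)"]) (auto simp: P_def)
qed

text \<open>The factor \<open>\<gamma> \<xi>\<close> lies in the groups of all earlier stages, so
  inserting it at stage \<xi> keeps the family coherent. At the first stage where \<open>S\<close>
  and \<open>T\<close> differ the limits agree, and the ratio is \<open>\<gamma> \<xi>\<close> or
  its inverse, neither of which lies in \<open>F_grp (Y \<xi>)\<close>.\<close>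

lemma coherent_families:
  fixes Y :: "nat set \<Rightarrow> nat set" and \<gamma> :: "nat set \<Rightarrow> nat \<Rightarrow> complex"
  assumes Y: "\<And>\<xi>. \<xi> \<in> Field aleph1 \<Longrightarrow> infinite (Y \<xi>)"
    and \<gamma>: "\<And>\<xi> x. \<xi> \<in> Field aleph1 \<Longrightarrow> cmod (\<gamma> \<xi> x) = 1"
    and \<gamma>_in: "\<And>\<xi> \<eta>. \<xi> \<in> Field aleph1 \<Longrightarrow> \<eta> \<in> underS aleph1 \<xi> \<Longrightarrow> \<gamma> \<xi> \<in> F_grp (Y \<eta>)"
    and \<gamma>_notin: "\<And>\<xi>. \<xi> \<in> Field aleph1 \<Longrightarrow> \<gamma> \<xi> \<notin> F_grp (Y \<xi>)"
  obtains \<alpha> :: "nat set set \<Rightarrow> nat set \<Rightarrow> nat \<Rightarrow> complex"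
  where "\<And>S \<xi> x. \<xi> \<in> Field aleph1 \<Longrightarrow> cmod (\<alpha> S \<xi> x) = 1"
    "\<And>S \<xi> \<eta>. (\<eta>, \<xi>) \<in> aleph1 \<Longrightarrow> (\<lambda>x. \<alpha> S \<xi> x / \<alpha> S \<eta> x) \<in> F_grp (Y \<eta>)"
    "\<And>S T. S \<subseteq> Field aleph1 \<Longrightarrow> T \<subseteq> Field aleph1 \<Longrightarrow>
      (\<And>\<xi>. \<xi> \<in> Field aleph1 \<Longrightarrow> (\<lambda>x. \<alpha> S \<xi> x / \<alpha> T \<xi> x) \<in> F_grp (Y \<xi>)) \<Longrightarrow> S = T"
proof -
  \<comment> \<open>The limit is chosen as a function of the stage and the earlier values alone, not
    of \<open>S\<close>. Equal histories thus receive the same limit, not merely congruent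
    ones.\<close>
  define ext where "ext \<xi> \<beta> = (SOME \<alpha>. (\<forall>x. cmod (\<alpha> x) = 1) \<and>
      (\<forall>\<eta>\<in>underS aleph1 \<xi>. (\<lambda>x. \<alpha> x / \<beta> \<eta> x) \<in> F_grp (Y \<eta>)))"
    for \<xi> and \<beta> :: "nat set \<Rightarrow> nat \<Rightarrow> complex"
  have ext_cong: "ext \<xi> \<beta> = ext \<xi> \<beta>'" if "\<And>\<eta>. \<eta> \<in> underS aleph1 \<xi> \<Longrightarrow> \<beta> \<eta> = \<beta>' \<eta>" for \<xi> \<beta> \<beta>'
    using that by (simp add: ext_def cong: ball_cong)
  have "\<exists>\<beta>. \<forall>\<xi>. \<beta> \<xi> = (\<lambda>x. ext \<xi> \<beta> x * (if \<xi> \<in> S then \<gamma> \<xi> x else 1))" for S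
  proof (rule dependent_wf_choice[OF aleph1.WF])
    show "\<delta> = (\<lambda>x. ext \<xi> f x * (if \<xi> \<in> S then \<gamma> \<xi> x else 1)) \<longleftrightarrow>
        \<delta> = (\<lambda>x. ext \<xi> g x * (if \<xi> \<in> S then \<gamma> \<xi> x else 1))"
      if "\<And>\<eta>. (\<eta>, \<xi>) \<in> aleph1 - Id \<Longrightarrow> f \<eta> = g \<eta>" for f g \<xi> \<delta>
    proof -
      have "ext \<xi> f = ext \<xi> g"
        by (rule ext_cong) (use that in \<open>auto simp: underS_def\<close>)
      then show ?thesis
        by simp
    qed
  qed blast
  then obtain \<alpha> where \<alpha>: "\<And>S \<xi>. \<alpha> S \<xi> = (\<lambda>x. ext \<xi> (\<alpha> S) x * (if \<xi> \<in> S then \<gamma> \<xi> x else 1))"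
    by metis
  have main: "(\<forall>x. cmod (ext \<xi> (\<alpha> S) x) = 1) \<and> (\<forall>x. cmod (\<alpha> S \<xi> x) = 1) \<and>
      (\<forall>\<eta>\<in>underS aleph1 \<xi>. (\<lambda>x. \<alpha> S \<xi> x / \<alpha> S \<eta> x) \<in> F_grp (Y \<eta>))"
    if "\<xi> \<in> Field aleph1" for S \<xi>
    using that
  proof (induction \<xi> rule: aleph1.well_order_induct)
    case (1 \<xi>)
    have IH: "\<eta> \<in> Field aleph1" "\<And>x. cmod (\<alpha> S \<eta> x) = 1"
      "\<And>\<zeta>. \<zeta> \<in> underS aleph1 \<eta> \<Longrightarrow> (\<lambda>x. \<alpha> S \<eta> x / \<alpha> S \<zeta> x) \<in> F_grp (Y \<zeta>)"
      if "\<eta> \<in> underS aleph1 \<xi>" for \<eta>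
      using 1 that by (auto simp: underS_def Field_def)
    have "\<exists>\<beta>. (\<forall>x. cmod (\<beta> x) = 1) \<and>
        (\<forall>\<eta>\<in>underS aleph1 \<xi>. (\<lambda>x. \<beta> x / \<alpha> S \<eta> x) \<in> F_grp (Y \<eta>))"
    proof (rule aleph1.coherent_limit)
      show "(\<lambda>x. \<alpha> S \<zeta> x / \<alpha> S \<eta> x) \<in> F_grp (Y \<eta>)"
        if "\<eta> \<in> underS aleph1 \<xi>" "\<zeta> \<in> underS aleph1 \<xi>" "(\<eta>, \<zeta>) \<in> aleph1" for \<eta> \<zeta>
      proof (cases "\<eta> = \<zeta>")
        case True
        have "\<alpha> S \<zeta> x \<noteq> 0" for x
          using IH(2)[OF that(2), of x] by auto
        then show ?thesis
          using True by (intro F_grp_eventually_const[of _ _ 0 1] Y IH(1)[OF that(1)]) auto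
      next
        case False
        then show ?thesis
          using that by (intro IH(3)) (auto simp: underS_def)
      qed
    qed (use IH(1,2) Y countable_underS_aleph1 1(2) in auto)
    then have ext: "\<forall>x. cmod (ext \<xi> (\<alpha> S) x) = 1"
        "\<forall>\<eta>\<in>underS aleph1 \<xi>. (\<lambda>x. ext \<xi> (\<alpha> S) x / \<alpha> S \<eta> x) \<in> F_grp (Y \<eta>)"
      unfolding ext_def by (rule someI2_ex; blast)+
    show ?case
    proof (intro conjI ballI)
      show "\<forall>x. cmod (\<alpha> S \<xi> x) = 1"
        using ext(1) \<gamma>[OF 1(2)] by (subst \<alpha>) (simp add: norm_mult)
      fix \<eta> assume \<eta>: "\<eta> \<in> underS aleph1 \<xi>"
      then have "(\<lambda>x. ext \<xi> (\<alpha> S) x / \<alpha> S \<eta> x) \<in> F_grp (Y \<eta>)"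
        using ext(2) by blast
      then have "(\<lambda>x. ext \<xi> (\<alpha> S) x / \<alpha> S \<eta> x * (if \<xi> \<in> S then \<gamma> \<xi> x else 1)) \<in> F_grp (Y \<eta>)"
        by (cases "\<xi> \<in> S") (use F_grp_mult[OF Y[OF IH(1)[OF \<eta>]] _ \<gamma>_in[OF 1(2) \<eta>]] in fastforce)+
      then show "(\<lambda>x. \<alpha> S \<xi> x / \<alpha> S \<eta> x) \<in> F_grp (Y \<eta>)"
        by (subst \<alpha>) simp
    qed (rule ext)
  qed
  show ?thesis
  proof (rule that)
    show "cmod (\<alpha> S \<xi> x) = 1" if "\<xi> \<in> Field aleph1" for S \<xi> x
      using main[OF that] by blast
    show "(\<lambda>x. \<alpha> S \<xi> x / \<alpha> S \<eta> x) \<in> F_grp (Y \<eta>)" if "(\<eta>, \<xi>) \<in> aleph1" for S \<xi> \<eta>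
    proof (cases "\<eta> = \<xi>")
      case True
      have \<xi>: "\<xi> \<in> Field aleph1"
        using that by (auto simp: Field_def)
      have "\<alpha> S \<xi> x \<noteq> 0" for x
        using main[OF \<xi>] by (metis norm_zero zero_neq_one)
      then show ?thesis
        using True by (intro F_grp_eventually_const[of _ _ 0 1]) (auto simp: Y[OF \<xi>])
    next
      case False
      then show ?thesis
        using that main[of \<xi>] by (auto simp: underS_def Field_def)
    qed
    show "S = T" if S: "S \<subseteq> Field aleph1" and T: "T \<subseteq> Field aleph1"
      and eq: "\<And>\<xi>. \<xi> \<in> Field aleph1 \<Longrightarrow> (\<lambda>x. \<alpha> S \<xi> x / \<alpha> T \<xi> x) \<in> F_grp (Y \<xi>)" for S T
    proof -
      \<comment> \<open>Equality of the sequences is carried through the induction because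
        \<open>ext_cong\<close> compares whole histories.\<close>
      have "(\<xi> \<in> S \<longleftrightarrow> \<xi> \<in> T) \<and> \<alpha> S \<xi> = \<alpha> T \<xi>" if "\<xi> \<in> Field aleph1" for \<xi>
        using that
      proof (induction \<xi> rule: aleph1.well_order_induct)
        case (1 \<xi>)
        have same: "ext \<xi> (\<alpha> S) = ext \<xi> (\<alpha> T)"
          by (rule ext_cong) (use 1 in \<open>auto simp: underS_def Field_def\<close>)
        have 0: "ext \<xi> (\<alpha> T) x \<noteq> 0" "\<gamma> \<xi> x \<noteq> 0" for x
          using main[OF 1(2)] \<gamma>[OF 1(2)] by (metis norm_zero zero_neq_one)+
        have "(\<lambda>x. (if \<xi> \<in> S then \<gamma> \<xi> x else 1) / (if \<xi> \<in> T then \<gamma> \<xi> x else 1)) \<in> F_grp (Y \<xi>)"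
          using eq[OF 1(2)] unfolding \<alpha>[of S \<xi>] \<alpha>[of T \<xi>] same by (simp add: 0)
        then have "\<xi> \<in> S \<longleftrightarrow> \<xi> \<in> T"
          using \<gamma>_notin[OF 1(2)] F_grp_inverse[OF Y[OF 1(2)], of "\<lambda>x. inverse (\<gamma> \<xi> x)"]
          by (cases "\<xi> \<in> S"; cases "\<xi> \<in> T") (simp_all add: divide_inverse)
        then show ?case
          using same \<alpha>[of S \<xi>] \<alpha>[of T \<xi>] by simp
      qed
      with S T show ?thesis
        by blast
    qed
  qed
qed

section \<open>Threads of cosets and the two cardinal bounds\<close>

text \<open>Cosets agree as soon as one representative lies in the other coset. This translates the
  ratios used so far into equalities in \<open>G_grp X\<close>.\<close>

lemma F_coset_eq_iff:
  assumes X: "infinite X" and \<alpha>: "\<And>x. cmod (\<alpha> x) = 1" and \<beta>: "\<And>x. cmod (\<beta> x) = 1"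
  shows "F_grp X #>\<^bsub>torus\<^esub> \<alpha> = F_grp X #>\<^bsub>torus\<^esub> \<beta> \<longleftrightarrow> (\<lambda>x. \<alpha> x / \<beta> x) \<in> F_grp X"
proof -
  interpret comm_group torus by (rule comm_group_torus)
  have carr: "\<alpha> \<in> carrier torus" "\<beta> \<in> carrier torus"
    using \<alpha> \<beta> by (auto simp: carrier_torus)
  have \<beta>0: "\<beta> x \<noteq> 0" for x
    using \<beta>[of x] by auto
  have "F_grp X #>\<^bsub>torus\<^esub> \<alpha> = F_grp X #>\<^bsub>torus\<^esub> \<beta> \<longleftrightarrow> \<alpha> \<in> F_grp X #>\<^bsub>torus\<^esub> \<beta>"
    using repr_independence[OF _ carr(2) subgroup_F_grp[OF X], of \<alpha>]
      rcos_self[OF carr(1) subgroup_F_grp[OF X]] by auto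
  also have "\<dots> \<longleftrightarrow> (\<lambda>x. \<alpha> x / \<beta> x) \<in> F_grp X"
  proof
    assume "\<alpha> \<in> F_grp X #>\<^bsub>torus\<^esub> \<beta>"
    then obtain h where "h \<in> F_grp X" "\<alpha> = (\<lambda>x. h x * \<beta> x)"
      by (auto simp: r_coset_def mult_torus)
    then show "(\<lambda>x. \<alpha> x / \<beta> x) \<in> F_grp X"
      using \<beta>0 by simp
  next
    assume "(\<lambda>x. \<alpha> x / \<beta> x) \<in> F_grp X"
    then have "(\<lambda>x. \<alpha> x / \<beta> x) \<otimes>\<^bsub>torus\<^esub> \<beta> \<in> F_grp X #>\<^bsub>torus\<^esub> \<beta>"
      by (rule rcosI[OF _ subgroup.subset[OF subgroup_F_grp[OF X]] carr(2)])
    then show "\<alpha> \<in> F_grp X #>\<^bsub>torus\<^esub> \<beta>"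
      using \<beta>0 by (simp add: mult_torus)
  qed
  finally show ?thesis .
qed

lemma carrier_lim_G:
  "x \<in> carrier (lim_G U) \<longleftrightarrow> x \<in> (\<Pi>\<^sub>E X\<in>U. (\<lambda>\<alpha>. F_grp X #>\<^bsub>torus\<^esub> \<alpha>) ` carrier torus) \<and>
    (\<forall>X\<in>U. \<forall>Y\<in>U. Y \<subseteq>\<^sup>* X \<longrightarrow> quot_map Y X (x Y) = x X)"
  by (simp add: lim_G_def inverse_limit_def G_grp_def carrier_FactGroup)

text \<open>Dedekind cuts of all real and imaginary parts. They code a complex sequence as a subset
  of a countable set, so that families of sequences can be counted by a power set.\<close>

definition cuts :: "(nat \<Rightarrow> complex) \<Rightarrow> (nat \<times> rat \<times> bool) set"
  where "cuts a = {(n, q, b). of_rat q < (if b then Re (a n) else Im (a n))}"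

lemma inj_cuts: "inj cuts"
proof (rule injI)
  fix a b assume eq: "cuts a = cuts b"
  have real_eq: "u = v" if "\<And>q. of_rat q < u \<longleftrightarrow> of_rat q < v" for u v :: real
    using that of_rat_dense[of u v] of_rat_dense[of v u]
    by (metis less_asym linorder_cases)
  have *: "(n, q, c) \<in> cuts a \<longleftrightarrow> (n, q, c) \<in> cuts b" for n q c
    using eq by simp
  have "Re (a n) = Re (b n)" for n
    using *[of n _ True] by (intro real_eq) (simp add: cuts_def)
  moreover have "Im (a n) = Im (b n)" for n
    using *[of n _ False] by (intro real_eq) (simp add: cuts_def)
  ultimately show "a = b"
    by (simp add: fun_eq_iff complex_eq_iff)
qed

lemma card_of_Pow_mono:
  assumes "|A| \<le>o |B|"
  shows "|Pow A| \<le>o |Pow B|"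
proof -
  obtain f where f: "inj_on f A" "f ` A \<subseteq> B"
    using assms card_of_ordLeq[of A B] by blast
  then have "inj_on (image f) (Pow A)" "image f ` Pow A \<subseteq> Pow B"
    by (auto intro: inj_on_image_Pow)
  then show ?thesis
    using card_of_ordLeq by blast
qed

text \<open>The connecting maps recover a thread from its values on the cofinal family
  \<open>Y\<close>. Each such value is a coset, determined by any chosen representative and thus by
  the cuts of that representative.\<close>

lemma card_lim_G_le:
  assumes inf: "\<And>X. X \<in> U \<Longrightarrow> infinite X"
    and Y: "\<And>\<xi>. \<xi> \<in> L \<Longrightarrow> Y \<xi> \<in> U" and cof: "\<And>X. X \<in> U \<Longrightarrow> \<exists>\<xi>\<in>L. Y \<xi> \<subseteq>\<^sup>* X"
  shows "|carrier (lim_G U)| \<le>o |Pow (L \<times> (UNIV :: (nat \<times> rat \<times> bool) set))|"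
proof -
  interpret T: comm_group torus by (rule comm_group_torus)
  define rep where "rep C = (SOME \<alpha>. \<alpha> \<in> C)" for C :: "(nat \<Rightarrow> complex) set"
  define \<Phi> where "\<Phi> x = Sigma L (\<lambda>\<xi>. cuts (rep (x (Y \<xi>))))" for x
  have rep: "F_grp X #>\<^bsub>torus\<^esub> rep (x X) = x X" if x: "x \<in> carrier (lim_G U)" and X: "X \<in> U" for x X
  proof -
    obtain \<alpha> where \<alpha>: "\<alpha> \<in> carrier torus" "x X = F_grp X #>\<^bsub>torus\<^esub> \<alpha>"
      using x PiE_mem[OF _ X] by (force simp: carrier_lim_G)
    then have "rep (x X) \<in> F_grp X #>\<^bsub>torus\<^esub> \<alpha>"
      unfolding rep_def using T.rcos_self[OF \<alpha>(1) subgroup_F_grp[OF inf[OF X]]] by (metis someI)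
    then show ?thesis
      using T.repr_independence[OF _ \<alpha>(1) subgroup_F_grp[OF inf[OF X]]] \<alpha>(2) by simp
  qed
  have "inj_on \<Phi> (carrier (lim_G U))"
  proof (rule inj_onI)
    fix x y assume x: "x \<in> carrier (lim_G U)" and y: "y \<in> carrier (lim_G U)" and eq: "\<Phi> x = \<Phi> y"
    have slice: "\<Phi> z `` {\<xi>} = cuts (rep (z (Y \<xi>)))" if "\<xi> \<in> L" for z \<xi>
      using that by (auto simp: \<Phi>_def)
    have xy_Y: "x (Y \<xi>) = y (Y \<xi>)" if "\<xi> \<in> L" for \<xi>
    proof -
      have "cuts (rep (x (Y \<xi>))) = cuts (rep (y (Y \<xi>)))"
        using slice[OF that] eq by metis
      then have "rep (x (Y \<xi>)) = rep (y (Y \<xi>))"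
        by (rule injD[OF inj_cuts])
      then show ?thesis
        using rep[OF x Y[OF that]] rep[OF y Y[OF that]] by metis
    qed
    have "x X = y X" if "X \<in> U" for X
    proof -
      obtain \<xi> where "\<xi> \<in> L" "Y \<xi> \<subseteq>\<^sup>* X"
        using cof \<open>X \<in> U\<close> by blast
      then show ?thesis
        using x y xy_Y[of \<xi>] Y[of \<xi>] \<open>X \<in> U\<close> by (metis carrier_lim_G)
    qed
    then show "x = y"
      using x y by (intro PiE_ext[of x U _ y]) (simp_all add: carrier_lim_G)
  qed
  moreover have "\<Phi> ` carrier (lim_G U) \<subseteq> Pow (L \<times> UNIV)"
    by (auto simp: \<Phi>_def)
  ultimately show ?thesis
    using card_of_ordLeq by blast
qed

text \<open>Each \<open>S\<close> yields the thread whose value at \<open>X\<close> is the class of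
  \<open>\<alpha> S \<xi>\<close> for any \<xi> with \<open>Y \<xi> \<subseteq>\<^sup>* X\<close>.
  Evaluating two threads at the sets \<open>Y \<xi>\<close> themselves brings \<open>sep\<close>
  into play and gives injectivity.\<close>

lemma card_lim_G_ge:
  assumes inf: "\<And>X. X \<in> U \<Longrightarrow> infinite X"
    and Y: "\<And>\<xi>. \<xi> \<in> Field aleph1 \<Longrightarrow> Y \<xi> \<in> U"
    and cof: "\<And>X. X \<in> U \<Longrightarrow> \<exists>\<xi>\<in>Field aleph1. Y \<xi> \<subseteq>\<^sup>* X"
    and \<alpha>: "\<And>S \<xi> x. \<xi> \<in> Field aleph1 \<Longrightarrow> cmod (\<alpha> S \<xi> x) = 1"
    and coh: "\<And>S \<xi> \<eta>. (\<eta>, \<xi>) \<in> aleph1 \<Longrightarrow> (\<lambda>x. \<alpha> S \<xi> x / \<alpha> S \<eta> x) \<in> F_grp (Y \<eta>)"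
    and sep: "\<And>S T. S \<subseteq> Field aleph1 \<Longrightarrow> T \<subseteq> Field aleph1 \<Longrightarrow>
      (\<And>\<xi>. \<xi> \<in> Field aleph1 \<Longrightarrow> (\<lambda>x. \<alpha> S \<xi> x / \<alpha> T \<xi> x) \<in> F_grp (Y \<xi>)) \<Longrightarrow> S = T"
  shows "|Pow (Field aleph1)| \<le>o |carrier (lim_G U)|"
proof -
  define idx where "idx X = (SOME \<xi>. \<xi> \<in> Field aleph1 \<and> Y \<xi> \<subseteq>\<^sup>* X)" for X
  have idx: "idx X \<in> Field aleph1" "Y (idx X) \<subseteq>\<^sup>* X" if "X \<in> U" for X
    using someI_ex[of "\<lambda>\<xi>. \<xi> \<in> Field aleph1 \<and> Y \<xi> \<subseteq>\<^sup>* X"] cof[OF that] unfolding idx_def by blast+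
  define \<Theta> where "\<Theta> S = (\<lambda>X\<in>U. F_grp X #>\<^bsub>torus\<^esub> \<alpha> S (idx X))" for S
  have le: "F_grp X #>\<^bsub>torus\<^esub> \<alpha> S \<eta> = F_grp X #>\<^bsub>torus\<^esub> \<alpha> S \<xi>"
    if X: "X \<in> U" and \<eta>: "Y \<eta> \<subseteq>\<^sup>* X" and le: "(\<eta>, \<xi>) \<in> aleph1" for X S \<eta> \<xi>
  proof -
    have F: "\<eta> \<in> Field aleph1" "\<xi> \<in> Field aleph1"
      using le by (auto simp: Field_def)
    have "(\<lambda>x. \<alpha> S \<xi> x / \<alpha> S \<eta> x) \<in> F_grp X"
      using coh[OF le] F_grp_mono[OF inf[OF X] inf[OF Y[OF F(1)]] \<eta>] by blast
    then show ?thesis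
      using F_coset_eq_iff[of X "\<alpha> S \<xi>" "\<alpha> S \<eta>"] inf[OF X] \<alpha> F by simp
  qed
  \<comment> \<open>The value does not depend on the index picked by \<open>idx\<close>: two
    admissible indices are comparable, and \<open>le\<close> equates their cosets.\<close>
  have \<Theta>: "\<Theta> S X = F_grp X #>\<^bsub>torus\<^esub> \<alpha> S \<xi>"
    if "X \<in> U" "\<xi> \<in> Field aleph1" "Y \<xi> \<subseteq>\<^sup>* X" for S X \<xi>
  proof -
    have "(idx X, \<xi>) \<in> aleph1 \<or> (\<xi>, idx X) \<in> aleph1"
      using aleph1.TOTALS that idx by blast
    then show ?thesis
      using le that idx by (auto simp: \<Theta>_def)
  qed
  have "inj_on \<Theta> (Pow (Field aleph1))"
  proof (rule inj_onI)
    fix S T assume ST: "S \<in> Pow (Field aleph1)" "T \<in> Pow (Field aleph1)" and eq: "\<Theta> S = \<Theta> T"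
    show "S = T"
    proof (rule sep)
      fix \<xi> assume \<xi>: "\<xi> \<in> Field aleph1"
      have "F_grp (Y \<xi>) #>\<^bsub>torus\<^esub> \<alpha> S \<xi> = F_grp (Y \<xi>) #>\<^bsub>torus\<^esub> \<alpha> T \<xi>"
        using \<Theta>[OF Y[OF \<xi>] \<xi>] eq by (metis Diff_cancel almost_subset_def finite.emptyI)
      then show "(\<lambda>x. \<alpha> S \<xi> x / \<alpha> T \<xi> x) \<in> F_grp (Y \<xi>)"
        using F_coset_eq_iff[of "Y \<xi>" "\<alpha> S \<xi>" "\<alpha> T \<xi>"] inf[OF Y[OF \<xi>]] \<alpha> \<xi> by simp
    qed (use ST in auto)
  qed
  moreover have "\<Theta> S \<in> carrier (lim_G U)" for S
    unfolding carrier_lim_G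
  proof (intro conjI ballI impI)
    show "\<Theta> S \<in> (\<Pi>\<^sub>E X\<in>U. (\<lambda>\<alpha>. F_grp X #>\<^bsub>torus\<^esub> \<alpha>) ` carrier torus)"
      using \<alpha> idx(1) by (auto simp: \<Theta>_def carrier_torus)
    fix X Z assume X: "X \<in> U" and Z: "Z \<in> U" and ZX: "Z \<subseteq>\<^sup>* X"
    \<comment> \<open>The index chosen for \<open>Z\<close> is admissible for \<open>X\<close> as
      well, so one sequence represents the thread at both sets.\<close>
    have "Y (idx Z) - X \<subseteq> (Y (idx Z) - Z) \<union> (Z - X)"
      by blast
    then have "Y (idx Z) \<subseteq>\<^sup>* X"
      using idx(2)[OF Z] ZX unfolding almost_subset_def by (meson finite_UnI finite_subset)
    then have "\<Theta> S X = F_grp X #>\<^bsub>torus\<^esub> \<alpha> S (idx Z)"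
      by (rule \<Theta>[OF X idx(1)[OF Z]])
    moreover have "\<Theta> S Z = F_grp Z #>\<^bsub>torus\<^esub> \<alpha> S (idx Z)"
      using Z by (simp add: \<Theta>_def)
    ultimately show "quot_map Z X (\<Theta> S Z) = \<Theta> S X"
      using quot_map_coset[OF inf[OF X] inf[OF Z] ZX] \<alpha>[OF idx(1)[OF Z]]
      by (simp add: carrier_torus)
  qed
  ultimately show ?thesis
    using card_of_ordLeq by blast
qed

theorem theorem2p5:
  fixes U :: "nat set set"
  assumes inf: "\<And>X. X \<in> U \<Longrightarrow> infinite X"
    and inter: "\<And>X Y. X \<in> U \<Longrightarrow> Y \<in> U \<Longrightarrow> X \<inter> Y \<in> U"
    and fin_mod: "\<And>X Y. X \<in> U \<Longrightarrow> finite ((X - Y) \<union> (Y - X)) \<Longrightarrow> Y \<in> U"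
    and aleph1_gen: "\<exists>Xs. (\<forall>\<xi>\<in>Field aleph1. Xs \<xi> \<in> U) \<and>
                          (\<forall>X\<in>U. \<exists>\<xi>\<in>Field aleph1. Xs \<xi> \<subseteq>\<^sup>* X)"
    and dominating: "\<And>f :: nat \<Rightarrow> nat. \<exists>X\<in>U. \<forall>\<^sub>\<infinity>i. f i \<le> nth_el X i"
  shows "|carrier (lim_G U)| =o ctwo ^c aleph1"
proof -
  obtain Xs where Xs: "\<And>\<xi>. \<xi> \<in> Field aleph1 \<Longrightarrow> Xs \<xi> \<in> U"
    and cof_Xs: "\<And>X. X \<in> U \<Longrightarrow> \<exists>\<xi>\<in>Field aleph1. Xs \<xi> \<subseteq>\<^sup>* X"
    using aleph1_gen by blast
  obtain Y \<gamma> where Y: "\<And>\<xi>. \<xi> \<in> Field aleph1 \<Longrightarrow> Y \<xi> \<in> U \<and> Y \<xi> \<subseteq> Xs \<xi>"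
    and \<gamma>: "\<And>\<xi> x. \<xi> \<in> Field aleph1 \<Longrightarrow> cmod (\<gamma> \<xi> x) = 1"
      "\<And>\<xi> \<eta>. \<xi> \<in> Field aleph1 \<Longrightarrow> \<eta> \<in> underS aleph1 \<xi> \<Longrightarrow> \<gamma> \<xi> \<in> F_grp (Y \<eta>)"
      "\<And>\<xi>. \<xi> \<in> Field aleph1 \<Longrightarrow> \<gamma> \<xi> \<notin> F_grp (Y \<xi>)"
    using cofinal_escaping_sets[where U = U and Xs = Xs, OF inf inter dominating Xs] by blast
  have YU: "Y \<xi> \<in> U" if "\<xi> \<in> Field aleph1" for \<xi>
    using Y[OF that] by blast
  have cof: "\<exists>\<xi>\<in>Field aleph1. Y \<xi> \<subseteq>\<^sup>* X" if X: "X \<in> U" for X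
  proof -
    obtain \<xi> where \<xi>: "\<xi> \<in> Field aleph1" "Xs \<xi> \<subseteq>\<^sup>* X"
      using cof_Xs[OF X] by blast
    have "Y \<xi> - X \<subseteq> Xs \<xi> - X"
      using Y[OF \<xi>(1)] by blast
    then show ?thesis
      using \<xi> unfolding almost_subset_def by (meson finite_subset)
  qed
  obtain \<alpha> where \<alpha>: "\<And>S \<xi> x. \<xi> \<in> Field aleph1 \<Longrightarrow> cmod (\<alpha> S \<xi> x) = 1"
    "\<And>S \<xi> \<eta>. (\<eta>, \<xi>) \<in> aleph1 \<Longrightarrow> (\<lambda>x. \<alpha> S \<xi> x / \<alpha> S \<eta> x) \<in> F_grp (Y \<eta>)"
    "\<And>S T. S \<subseteq> Field aleph1 \<Longrightarrow> T \<subseteq> Field aleph1 \<Longrightarrow>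
      (\<And>\<xi>. \<xi> \<in> Field aleph1 \<Longrightarrow> (\<lambda>x. \<alpha> S \<xi> x / \<alpha> T \<xi> x) \<in> F_grp (Y \<xi>)) \<Longrightarrow> S = T"
    using coherent_families[of Y \<gamma>, OF inf[OF YU] \<gamma>] by blast
  have inf_aleph1: "infinite (Field aleph1)"
    by (simp add: cardSuc_finite[OF natLeq_Card_order] Field_natLeq)
  have "|Pow (Field aleph1)| \<le>o |carrier (lim_G U)|"
    by (rule card_lim_G_ge[OF inf YU cof \<alpha>])
  moreover have "|carrier (lim_G U)| \<le>o |Pow (Field aleph1)|"
  proof -
    \<comment> \<open>The countable set of codes for cuts is absorbed by the infinite cardinal,
      which brings the bound of \<open>card_lim_G_le\<close> down to the power set of
      \<open>Field aleph1\<close>.\<close>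
    have "|UNIV :: (nat \<times> rat \<times> bool) set| \<le>o natLeq"
      by (simp flip: countable_card_le_natLeq)
    also have "natLeq \<le>o |Field aleph1|"
      using inf_aleph1 infinite_iff_natLeq_ordLeq by blast
    finally have "|Field aleph1 \<times> (UNIV :: (nat \<times> rat \<times> bool) set)| \<le>o |Field aleph1|"
      using inf_aleph1 by (intro card_of_Times_ordLeq_infinite_Field)
        (simp_all add: Field_card_of card_of_card_order_on card_of_refl ordIso_imp_ordLeq)
    then have "|Pow (Field aleph1 \<times> (UNIV :: (nat \<times> rat \<times> bool) set))| \<le>o |Pow (Field aleph1)|"
      by (rule card_of_Pow_mono)
    with card_lim_G_le[OF inf YU cof] show ?thesis
      by (rule ordLeq_transitive)
  qed
  ultimately have "|carrier (lim_G U)| =o |Pow (Field aleph1)|"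
    by (simp add: ordIso_iff_ordLeq)
  also have "|Pow (Field aleph1)| =o ctwo ^c aleph1"
    unfolding cexp_def ctwo_def Field_card_of by (rule card_of_Pow_Func)
  finally show ?thesis .
qed

end
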